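(* Let $n\ge1$ and let $f,g:\mathbb{R}^n\times\mathbb{T}^n\to\mathbb{R}$ be functions that are Lebesgue integrable together with their squares. For $t\in\mathbb{R}$ put $$K(t)=\int_{\mathbb{R}^n}\int_{\mathbb{T}^n} f(\omega,\,x-\omega t)\,g(\omega,x)\,d^nx\,d^n\omega .$$ Then the limits of $K(t)$ as $t\to+\infty$ and as $t\to-\infty$ exist and $$\lim_{t\to\pm\infty}K(t)=(2\pi)^n\int_{\mathbb{R}^n}\overline{f}(\omega)\,\overline{g}(\omega)\,d^n\omega,$$ where, for almost every $\omega$, $$\overline{f}(\omega)=\frac{1}{(2\pi)^n}\int_{\mathbb{T}^n}f(\omega,x)\,d^nx,\qquad \overline{g}(\omega)=\frac{1}{(2\pi)^n}\int_{\mathbb{T}^n}g(\omega,x)\,d^nx .$$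
   Context: $\mathbb{T}^n=\{x=(x_1,\dots,x_n)\bmod 2\pi\}=(\mathbb{R}/2\pi\mathbb{Z})^n$, with $d^nx$ the Lebesgue measure of total mass $(2\pi)^n$; functions on $\mathbb{R}^n\times\mathbb{T}^n$ are identified with functions $2\pi$-periodic in each $x_s$, and $x-\omega t$ is taken modulo $2\pi$ in each coordinate. *)

theory Defs
  imports "HOL-Analysis.Analysis"
begin

text \<open>
  A function on the torus $(\mathbb{R}/2\pi\mathbb{Z})^n$ is represented by a function on
  \<^typ>\<open>real ^ 'n\<close> that is $2\pi$-periodic in every coordinate, with $n$ the (arbitrary, positive)
  cardinality of the index type. Integrals over the torus are Lebesgue integrals over the fundamental
  cell $[0,2\pi)^n$, so the torus has total mass $(2\pi)^n$. For a periodic function, evaluation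
  at \<open>x - t *\<^sub>R \<omega>\<close> needs no explicit reduction modulo $2\pi$.
\<close>

definition torus_cell :: "(real ^ 'n) set" where
  "torus_cell = {x. \<forall>s. 0 \<le> x $ s \<and> x $ s < 2 * pi}"

definition torus_periodic :: "((real ^ 'n) \<times> (real ^ 'n) \<Rightarrow> real) \<Rightarrow> bool" where
  "torus_periodic f \<longleftrightarrow> (\<forall>\<omega> x s. f (\<omega>, x + axis s (2 * pi)) = f (\<omega>, x))"

abbreviation phase_integrable :: "((real ^ 'n) \<times> (real ^ 'n) \<Rightarrow> real) \<Rightarrow> bool" where
  "phase_integrable f \<equiv> set_integrable lebesgue (UNIV \<times> torus_cell) f"

definition correlation ::
  "((real ^ 'n) \<times> (real ^ 'n) \<Rightarrow> real) \<Rightarrow> ((real ^ 'n) \<times> (real ^ 'n) \<Rightarrow> real) \<Rightarrow> real \<Rightarrow> real" where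
  "correlation f g t =
     (LINT \<omega>|lebesgue. (LINT x:torus_cell|lebesgue. f (\<omega>, x - t *\<^sub>R \<omega>) * g (\<omega>, x)))"

definition torus_mean :: "((real ^ 'n) \<times> (real ^ 'n) \<Rightarrow> real) \<Rightarrow> real ^ 'n \<Rightarrow> real" where
  "torus_mean f \<omega> = 1 / (2 * pi) ^ CARD('n) * (LINT x:torus_cell|lebesgue. f (\<omega>, x))"

end

theory Submission
  imports Defs
begin

text \<open>
  Substituting \<open>\<omega> \<mapsto> \<omega> - v/t\<close> in \<open>K(t)\<close> turns \<open>f(\<omega>, x - t\<omega>)\<close> into \<open>f(\<omega> - v/t, x - t\<omega> + v)\<close>.
  Translation is continuous in $L^1$, so for bounded \<open>f\<close>, \<open>g\<close> and large \<open>t\<close> the remaining shifts by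
  \<open>v/t\<close> are negligible, uniformly in \<open>v\<close> in the torus cell, and
  \<open>K(t) = \<integral>\<integral> f(\<omega>, x - t\<omega> + v) g(\<omega>, x) + o(1)\<close>. Averaging over \<open>v\<close> replaces \<open>f\<close> by its torus mean and
  gives the limit, without Fourier series. Truncation and the Cauchy-Schwarz inequality, with
  bounds uniform in \<open>t\<close>, reduce the general case to the bounded one.
\<close>

subsection \<open>Torus measure and shear invariance\<close>

text \<open>The flow \<open>x - t *\<^sub>R \<omega>\<close> stretches differences of frequencies by
  the factor t. A whole period of phases is therefore swept out by frequencies within distance
  O(1/|t|) of \<omega>, over which an integrable function hardly changes in the mean. Only the size
  of t matters, so the filter \<open>at_infinity\<close> treats both signs at once. Boundedness
  enters because the frequency shift acts on a product: if one factor is bounded, the change of the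
  other has to be small in L1 only. Two obstacles shape the rest. A translation of the torus leaves
  the fundamental cell, so it is modelled as a translation followed by \<open>torus_reduce\<close>,
  and its invariance comes from unfolding over the lattice. A Lebesgue measurable function can have
  non-measurable sections, so f and g are replaced by periodic Borel functions equal to them almost
  everywhere; the flow respects this because it preserves the measure.\<close>

definition torus_measure :: "(real ^ 'n) measure" where
  "torus_measure = density lborel (indicator torus_cell)"

definition lattice_point :: "int ^ 'n \<Rightarrow> real ^ 'n" where
  "lattice_point k = (\<chi> s. 2 * pi * of_int (k $ s))"

definition torus_reduce :: "real ^ 'n \<Rightarrow> real ^ 'n" where
  "torus_reduce x = x - lattice_point (\<chi> s. \<lfloor>x $ s / (2 * pi)\<rfloor>)"

lemma torus_cell_borel [measurable]: "(torus_cell :: (real ^ 'n) set) \<in> sets borel"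
proof -
  have "torus_cell = (\<Inter>s. {x :: real ^ 'n. 0 \<le> x $ s} \<inter> {x. x $ s < 2 * pi})"
    by (auto simp: torus_cell_def)
  also have "\<dots> \<in> sets borel"
    by (intro sets.countable_INT'' sets.Int borel_closed borel_open closed_Collect_le open_Collect_less
        continuous_intros) auto
  finally show ?thesis .
qed

lemma bounded_torus_cell: "bounded (torus_cell :: (real ^ 'n) set)"
  by (rule bounded_subset[of "cbox 0 (\<chi> s. 2 * pi)"])
     (auto simp: torus_cell_def mem_box_cart less_imp_le)

lemma sets_torus_measure [simp, measurable_cong]: "sets torus_measure = sets borel"
  and space_torus_measure [simp]: "space torus_measure = UNIV"
  by (simp_all add: torus_measure_def)

lemma emeasure_torus_measure_UNIV:
  "emeasure (torus_measure :: (real ^ 'n) measure) UNIV = ennreal ((2 * pi) ^ CARD('n))"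
proof -
  let ?b = "(\<chi> s. 2 * pi) :: real ^ 'n"
  have "emeasure torus_measure (UNIV :: (real ^ 'n) set) = emeasure lborel (torus_cell :: (real ^ 'n) set)"
    by (simp add: torus_measure_def emeasure_density)
  also have "\<dots> = emeasure lborel (cbox 0 ?b)"
  proof (rule antisym)
    show "emeasure lborel (torus_cell :: (real ^ 'n) set) \<le> emeasure lborel (cbox 0 ?b)"
      by (intro emeasure_mono) (auto simp: torus_cell_def mem_box_cart less_imp_le)
    have "emeasure lborel (cbox 0 ?b) = emeasure lborel (box 0 ?b)"
      by (simp add: emeasure_lborel_cbox_eq emeasure_lborel_box_eq)
    also have "\<dots> \<le> emeasure lborel (torus_cell :: (real ^ 'n) set)"
      by (intro emeasure_mono) (auto simp: torus_cell_def mem_box_cart less_imp_le)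
    finally show "emeasure lborel (cbox 0 ?b) \<le> emeasure lborel (torus_cell :: (real ^ 'n) set)" .
  qed
  also have "\<dots> = ennreal (measure lborel (cbox 0 ?b))"
    using emeasure_compact_finite[OF compact_cbox, of 0 ?b]
    by (intro emeasure_eq_ennreal_measure) (simp add: less_top)
  also have "measure lborel (cbox 0 ?b) = (2 * pi) ^ CARD('n)"
    by (subst content_cbox_cart) (auto simp: interval_ne_empty_cart)
  finally show ?thesis .
qed

lemma finite_torus_measure: "finite_measure torus_measure"
  by (rule finite_measureI) (simp add: emeasure_torus_measure_UNIV)

lemma measure_torus_measure_UNIV:
  "measure (torus_measure :: (real ^ 'n) measure) UNIV = (2 * pi) ^ CARD('n)"
  by (simp add: measure_def emeasure_torus_measure_UNIV)

lemma torus_reduce_borel [measurable]: "(torus_reduce :: real ^ 'n \<Rightarrow> _) \<in> borel_measurable borel"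
proof -
  have [measurable]: "(\<lambda>x :: real ^ 'n. x $ s) \<in> borel_measurable borel" for s
    by (intro borel_measurable_continuous_onI continuous_intros)
  have "(\<lambda>x :: real ^ 'n. torus_reduce x $ s) \<in> borel_measurable borel" for s
    unfolding torus_reduce_def lattice_point_def by simp
  then show ?thesis
    by (subst borel_measurable_euclidean_space) (auto simp: Basis_vec_def inner_axis)
qed

text \<open>The cell is half-open, so in each coordinate the floor is the only possible lattice
  index. This uniqueness makes the tiling exact, with no overlap along faces.\<close>

lemma lattice_translate_in_cell_iff:
  "z - lattice_point k \<in> torus_cell \<longleftrightarrow> k = (\<chi> s. \<lfloor>z $ s / (2 * pi)\<rfloor>)"
proof -
  have "0 \<le> z $ s - 2 * pi * of_int (k $ s) \<and> z $ s - 2 * pi * of_int (k $ s) < 2 * pi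
    \<longleftrightarrow> \<lfloor>z $ s / (2 * pi)\<rfloor> = k $ s" for s
    by (subst floor_eq_iff) (auto simp: field_simps)
  then show ?thesis
    by (auto simp: torus_cell_def lattice_point_def vec_eq_iff)
qed

lemma torus_reduce_in_cell: "torus_reduce x \<in> torus_cell"
  unfolding torus_reduce_def by (subst lattice_translate_in_cell_iff) simp

lemma torus_reduce_eq_self:
  assumes "x \<in> torus_cell"
  shows "torus_reduce x = x"
proof -
  have "(\<chi> s. \<lfloor>x $ s / (2 * pi)\<rfloor>) = 0"
    using lattice_translate_in_cell_iff[of x 0] assms
    by (simp add: lattice_point_def zero_vec_def[symmetric])
  then show ?thesis
    by (simp add: torus_reduce_def lattice_point_def vec_eq_iff)
qed

lemma torus_reduce_lattice: "torus_reduce (x - lattice_point k) = torus_reduce x"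
  by (simp add: torus_reduce_def lattice_point_def vec_eq_iff diff_divide_distrib algebra_simps)

lemma torus_reduce_add: "torus_reduce (torus_reduce x + y) = torus_reduce (x + y)"
  using torus_reduce_lattice[of "x + y" "\<chi> s. \<lfloor>x $ s / (2 * pi)\<rfloor>"]
  by (simp add: torus_reduce_def[of x] algebra_simps)

lemma lattice_translates_tile:
  "(\<integral>\<^sup>+k. indicator torus_cell (z - lattice_point k) \<partial>count_space UNIV) = 1"
proof -
  have "(\<integral>\<^sup>+k. indicator torus_cell (z - lattice_point k) \<partial>count_space UNIV) =
      (\<integral>\<^sup>+k. indicator {\<chi> s. \<lfloor>z $ s / (2 * pi)\<rfloor>} k \<partial>count_space UNIV)"
    by (intro nn_integral_cong) (auto simp: indicator_def lattice_translate_in_cell_iff)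
  also have "\<dots> = 1"
    by simp
  finally show ?thesis .
qed

lemma lattice_translates_tile_add:
  "(\<integral>\<^sup>+k. indicator torus_cell (z + lattice_point k) \<partial>count_space UNIV) = 1"
proof -
  have "(\<integral>\<^sup>+k. indicator torus_cell (z + lattice_point k) \<partial>count_space UNIV) =
      (\<integral>\<^sup>+k. indicator torus_cell (z - lattice_point (- k)) \<partial>count_space UNIV)"
    by (simp add: lattice_point_def vec_eq_iff cong: nn_integral_cong) (simp add: plus_vec_def minus_vec_def)
  also have "\<dots> = (\<integral>\<^sup>+k. indicator torus_cell (z - lattice_point k) \<partial>count_space UNIV)"
    by (rule nn_integral_bij_count_space) (rule bij_uminus)
  finally show ?thesis
    by (simp add: lattice_translates_tile)
qed

lemma nn_integral_torus_measure:
  assumes [measurable]: "h \<in> borel_measurable borel"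
  shows "(\<integral>\<^sup>+x. h x \<partial>torus_measure) = (\<integral>\<^sup>+x. h x * indicator torus_cell x \<partial>lborel)"
  by (simp add: torus_measure_def nn_integral_density mult.commute)

lemma nn_integral_lborel_translate:
  fixes c :: "'a :: euclidean_space"
  assumes [measurable]: "h \<in> borel_measurable borel"
  shows "(\<integral>\<^sup>+x. h (x + c) \<partial>lborel) = (\<integral>\<^sup>+x. h x \<partial>lborel)"
proof -
  have "(\<integral>\<^sup>+x. h x \<partial>lborel) = (\<integral>\<^sup>+x. h x \<partial>distr lborel borel ((+) c))"
    by (simp add: lborel_distr_plus)
  also have "\<dots> = (\<integral>\<^sup>+x. h (x + c) \<partial>lborel)"
    by (subst nn_integral_distr) (auto simp: add.commute)
  finally show ?thesis by simp
qed

text \<open>The indicators of the lattice translates of the cell sum to 1 at every point. Inserting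
  this sum and exchanging it with the integral cuts the space into cells, each of which is then
  moved back to the fundamental one.\<close>

lemma nn_integral_lborel_tiling:
  fixes h :: "real ^ 'n \<Rightarrow> ennreal"
  assumes [measurable]: "h \<in> borel_measurable borel"
  shows "(\<integral>\<^sup>+x. h x \<partial>lborel) = (\<integral>\<^sup>+k. \<integral>\<^sup>+y. h (y - lattice_point k) \<partial>torus_measure \<partial>count_space UNIV)"
proof -
  have "(\<integral>\<^sup>+x. h x \<partial>lborel) =
      (\<integral>\<^sup>+x. \<integral>\<^sup>+k. h x * indicator torus_cell (x + lattice_point k) \<partial>count_space UNIV \<partial>lborel)"
    by (simp add: nn_integral_cmult lattice_translates_tile_add)
  also have "\<dots> = (\<integral>\<^sup>+k. \<integral>\<^sup>+x. h x * indicator torus_cell (x + lattice_point k) \<partial>lborel \<partial>count_space UNIV)"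
    by (intro nn_integral_count_space_nn_integral) auto
  also have "\<dots> = (\<integral>\<^sup>+k. \<integral>\<^sup>+y. h (y - lattice_point k) \<partial>torus_measure \<partial>count_space UNIV)"
  proof (intro nn_integral_cong)
    fix k
    have "(\<integral>\<^sup>+x. h x * indicator torus_cell (x + lattice_point k) \<partial>lborel) =
        (\<integral>\<^sup>+x. h (x - lattice_point k) * indicator torus_cell x \<partial>lborel)"
      by (subst nn_integral_lborel_translate[of _ "- lattice_point k", symmetric]) auto
    then show "(\<integral>\<^sup>+x. h x * indicator torus_cell (x + lattice_point k) \<partial>lborel) =
        (\<integral>\<^sup>+y. h (y - lattice_point k) \<partial>torus_measure)"
      by (simp add: nn_integral_torus_measure)
  qed
  finally show ?thesis .
qed

text \<open>The shifted cell is again a fundamental domain. After tiling,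
  \<open>h (torus_reduce y)\<close> does not depend on the lattice index, and the indicators of the
  translates of the shifted cell add up to 1.\<close>

lemma nn_integral_torus_translate:
  fixes h :: "real ^ 'n \<Rightarrow> ennreal"
  assumes [measurable]: "h \<in> borel_measurable borel"
  shows "(\<integral>\<^sup>+x. h (torus_reduce (x + c)) \<partial>torus_measure) = (\<integral>\<^sup>+x. h x \<partial>torus_measure)"
proof -
  have "(\<integral>\<^sup>+x. h (torus_reduce (x + c)) \<partial>torus_measure) =
      (\<integral>\<^sup>+x. h (torus_reduce (x + c)) * indicator torus_cell x \<partial>lborel)"
    by (simp add: nn_integral_torus_measure)
  also have "\<dots> = (\<integral>\<^sup>+x. h (torus_reduce x) * indicator torus_cell (x - c) \<partial>lborel)"
    by (subst nn_integral_lborel_translate[of _ "- c", symmetric]) auto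
  also have "\<dots> = (\<integral>\<^sup>+k. \<integral>\<^sup>+y. h (torus_reduce y) * indicator torus_cell (y - c - lattice_point k)
      \<partial>torus_measure \<partial>count_space UNIV)"
    by (subst nn_integral_lborel_tiling) (auto simp: torus_reduce_lattice algebra_simps)
  also have "\<dots> = (\<integral>\<^sup>+y. \<integral>\<^sup>+k. h (torus_reduce y) * indicator torus_cell (y - c - lattice_point k)
      \<partial>count_space UNIV \<partial>torus_measure)"
    by (intro nn_integral_count_space_nn_integral[symmetric]) auto
  also have "\<dots> = (\<integral>\<^sup>+y. h (torus_reduce y) \<partial>torus_measure)"
    by (simp add: nn_integral_cmult lattice_translates_tile)
  also have "\<dots> = (\<integral>\<^sup>+y. h y \<partial>torus_measure)"
    by (simp add: nn_integral_torus_measure)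
       (auto intro!: nn_integral_cong simp: indicator_def torus_reduce_eq_self)
  finally show ?thesis .
qed

section \<open>Phase space and its measure-preserving shears\<close>

abbreviation phase_measure :: "((real ^ 'n) \<times> (real ^ 'n)) measure" where
  "phase_measure \<equiv> lborel \<Otimes>\<^sub>M torus_measure"

lemma sets_phase_measure: "sets phase_measure = sets borel"
  by (simp add: borel_prod[symmetric] cong: sets_pair_measure_cong)

lemma space_phase_measure [simp]: "space phase_measure = UNIV"
  by (simp add: space_pair_measure)

interpretation torus: finite_measure torus_measure
  by (rule finite_torus_measure)

interpretation phase: pair_sigma_finite lborel torus_measure ..

text \<open>Translation by \<open>c \<omega>\<close> preserves every fibre integral, however c
  varies with \<omega>; what remains is a translation of Lebesgue measure by a. Arbitrary Borel c
  covers the flow \<open>- t *\<^sub>R \<omega>\<close>, a constant phase v, and their sum.\<close>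

lemma phase_measure_shear:
  fixes a :: "real ^ 'n" and c :: "real ^ 'n \<Rightarrow> real ^ 'n"
  assumes [measurable]: "c \<in> borel_measurable borel"
  defines "S \<equiv> (\<lambda>(\<omega>, x). (\<omega> + a, torus_reduce (x + c \<omega>)))"
  shows "S \<in> phase_measure \<rightarrow>\<^sub>M phase_measure" and "distr phase_measure phase_measure S = phase_measure"
proof -
  show S [measurable]: "S \<in> phase_measure \<rightarrow>\<^sub>M phase_measure"
    unfolding S_def by measurable
  show "distr phase_measure phase_measure S = phase_measure"
  proof (rule measure_eqI)
    fix A assume "A \<in> sets (distr phase_measure phase_measure S)"
    then have A [measurable]: "A \<in> sets phase_measure" by (simp only: sets_distr)
    have "emeasure (distr phase_measure phase_measure S) A = (\<integral>\<^sup>+z. indicator A z \<partial>distr phase_measure phase_measure S)"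
      by (rule nn_integral_indicator[symmetric]) (simp only: sets_distr A)
    also have "\<dots> = (\<integral>\<^sup>+z. indicator A (S z) \<partial>phase_measure)"
      by (intro nn_integral_distr) measurable
    also have "\<dots> = (\<integral>\<^sup>+\<omega>. \<integral>\<^sup>+x. indicator A (\<omega> + a, torus_reduce (x + c \<omega>)) \<partial>torus_measure \<partial>lborel)"
      by (subst torus.nn_integral_fst[symmetric]) (auto simp: S_def)
    also have "\<dots> = (\<integral>\<^sup>+\<omega>. \<integral>\<^sup>+x. indicator A (\<omega> + a, x) \<partial>torus_measure \<partial>lborel)"
      by (intro nn_integral_cong nn_integral_torus_translate) measurable
    also have "\<dots> = (\<integral>\<^sup>+\<omega>. \<integral>\<^sup>+x. indicator A (\<omega>, x) \<partial>torus_measure \<partial>lborel)"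
      by (intro nn_integral_lborel_translate) measurable
    also have "\<dots> = (\<integral>\<^sup>+z. indicator A z \<partial>phase_measure)"
      by (subst torus.nn_integral_fst[symmetric]) auto
    also have "\<dots> = emeasure phase_measure A"
      by (rule nn_integral_indicator) fact
    finally show "emeasure (distr phase_measure phase_measure S) A = emeasure phase_measure A" .
  qed simp
qed

subsection \<open>Continuity of translation in $L^1$\<close>

lemma inner_regular_compact_lborel:
  fixes A :: "'a :: euclidean_space set"
  assumes A [measurable]: "A \<in> sets borel" and fin: "emeasure lborel A < \<infinity>" and e: "0 < e"
  obtains K where "compact K" "K \<subseteq> A" "emeasure lborel (A - K) < ennreal e"
proof -
  obtain T where T: "closed T" "T \<subseteq> A" "emeasure lebesgue (A - T) < ennreal e"
  proof (rule sets_lebesgue_inner_closed)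
    show "A \<in> sets lebesgue" using A by simp
  qed (use e in auto)
  have [measurable]: "T \<in> sets borel" using T by auto
  \<comment> \<open>The right-hand side parses as \<open>A - (T \<inter> cball 0 (real n))\<close>,
    the part of A lost when T is cut down to a compact set. These sets decrease to
    \<open>A - T\<close>, and the finite measure of A gives continuity from above.\<close>
  define D where "D n = A - T \<inter> cball 0 (real n)" for n
  have D: "range D \<subseteq> sets lborel" "decseq D"
    unfolding D_def decseq_def by auto
  have "emeasure lborel (D i) \<noteq> \<infinity>" for i
    using emeasure_mono[of "D i" A lborel] fin by (auto simp: D_def top_unique)
  then have "(\<lambda>n. emeasure lborel (D n)) \<longlonglongrightarrow> emeasure lborel (\<Inter>n. D n)"
    using D by (intro Lim_emeasure_decseq)
  moreover have "(\<Inter>n. D n) = A - T"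
  proof -
    have "x \<in> A - T" if "\<forall>n. x \<in> D n" for x
      using real_arch_simple[of "norm x"] that by (auto simp: D_def)
    moreover have "x \<in> D n" if "x \<in> A - T" for x n
      using that by (simp add: D_def)
    ultimately show ?thesis
      by blast
  qed
  moreover have "emeasure lborel (A - T) < ennreal e"
    using T by (subst (asm) emeasure_completion) auto
  ultimately have "\<forall>\<^sub>F n in sequentially. emeasure lborel (D n) < ennreal e"
    by (metis order_tendstoD(2))
  then obtain n where "emeasure lborel (D n) < ennreal e"
    using eventually_happens by force
  then show ?thesis
    using T by (intro that[of "T \<inter> cball 0 (real n)"]) (auto simp: D_def closed_Int_compact)
qed

text \<open>Let K \<subseteq> A \<subseteq> U with K compact and U open. If h is shorter than the
  margin d of K in U, then a point of K moved by h or -h stays in U. Hence the two indicators can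
  differ only if z or z + h lies in \<open>A - K\<close> or \<open>U - A\<close>: four events, each
  of measure below e/4.\<close>

lemma nn_integral_translation_diff_indicator:
  fixes A :: "'a :: euclidean_space set"
  assumes A [measurable]: "A \<in> sets borel" and fin: "emeasure lborel A < \<infinity>" and e: "0 < (e :: real)"
  shows "\<forall>\<^sub>F h in nhds 0. (\<integral>\<^sup>+z. ennreal \<bar>indicator A (z + h) - indicator A z\<bar> \<partial>lborel) \<le> ennreal e"
proof -
  obtain U where U: "open U" "A \<subseteq> U" and mU: "emeasure lborel (U - A) < ennreal (e / 4)"
    using outer_regular_lborel[of A "e / 4"] A e by auto
  obtain K where K: "compact K" "K \<subseteq> A" and mK: "emeasure lborel (A - K) < ennreal (e / 4)"
    using inner_regular_compact_lborel[of A "e / 4"] A e fin by auto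
  obtain d where d: "0 < d" "(\<Union>x\<in>K. ball x d) \<subseteq> U"
    using compact_subset_open_imp_ball_epsilon_subset[of K U] K U by auto
  have [measurable]: "U \<in> sets borel" "K \<in> sets borel"
    using U K by (simp_all add: borel_compact)
  have "(\<integral>\<^sup>+z. ennreal \<bar>indicator A (z + h) - indicator A z\<bar> \<partial>lborel) \<le> ennreal e" if h: "dist h 0 < d" for h
  proof -
    have 1: "z + h \<in> U" if "z \<in> K" for z
      using h that by (intro subsetD[OF d(2)] UN_I[of z]) (auto simp: dist_norm)
    have 2: "z \<in> U" if "z + h \<in> K" for z
      using h that by (intro subsetD[OF d(2)] UN_I[of "z + h"]) (auto simp: dist_norm)
    have "(\<integral>\<^sup>+z. ennreal \<bar>indicator A (z + h) - indicator A z\<bar> \<partial>lborel) \<le>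
       (\<integral>\<^sup>+z. (indicator (A - K) (z + h) + indicator (U - A) (z + h)) +
              (indicator (A - K) z + indicator (U - A) z) \<partial>lborel)"
      using K(2) U(2) by (intro nn_integral_mono) (auto simp: indicator_def dest: 1 2)
    also have "\<dots> = (\<integral>\<^sup>+z. indicator (A - K) (z + h) + indicator (U - A) (z + h) \<partial>lborel) +
       (\<integral>\<^sup>+z. indicator (A - K) z + indicator (U - A) z \<partial>lborel)"
      by (rule nn_integral_add) auto
    also have "(\<integral>\<^sup>+z. indicator (A - K) (z + h) + indicator (U - A) (z + h) \<partial>lborel) =
       (\<integral>\<^sup>+z. indicator (A - K) z + indicator (U - A) z \<partial>lborel)"
      by (rule nn_integral_lborel_translate) auto
    also have "(\<integral>\<^sup>+z. indicator (A - K) z + indicator (U - A) z \<partial>lborel) =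
       emeasure lborel (A - K) + emeasure lborel (U - A)"
      by (subst nn_integral_add) auto
    also have "\<dots> + (emeasure lborel (A - K) + emeasure lborel (U - A)) \<le>
       (ennreal (e / 4) + ennreal (e / 4)) + (ennreal (e / 4) + ennreal (e / 4))"
      using mU mK by (intro add_mono less_imp_le)
    also have "\<dots> = ennreal e"
      using e by (simp flip: ennreal_plus)
    finally show ?thesis .
  qed
  then show ?thesis
    using d(1) unfolding eventually_nhds_metric by blast
qed

text \<open>The property passes to L1 limits because translation is an L1 isometry: the error of
  approximating f by \<open>s i\<close> is counted once at z + h and once at z, with the same
  value.\<close>

lemma L1_translation_continuous:
  fixes f :: "'a :: euclidean_space \<Rightarrow> real"
  assumes "integrable lborel f" and "0 < e"
  shows "\<forall>\<^sub>F h in nhds 0. (\<integral>\<^sup>+z. ennreal \<bar>f (z + h) - f z\<bar> \<partial>lborel) \<le> ennreal e"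
  using assms
proof (induction arbitrary: e rule: integrable_induct)
  case (base A c)
  have [measurable]: "A \<in> sets borel" using base by simp
  \<comment> \<open>The summand 1 keeps the tolerance meaningful for c = 0.\<close>
  have "\<forall>\<^sub>F h in nhds 0. (\<integral>\<^sup>+z. ennreal \<bar>indicator A (z + h) - indicator A z\<bar> \<partial>lborel) \<le> ennreal (e / (\<bar>c\<bar> + 1))"
    using base by (intro nn_integral_translation_diff_indicator) auto
  then show ?case
  proof eventually_elim
    case (elim h)
    have "(\<integral>\<^sup>+z. ennreal \<bar>indicator A (z + h) *\<^sub>R c - indicator A z *\<^sub>R c\<bar> \<partial>lborel) =
        (\<integral>\<^sup>+z. ennreal \<bar>c\<bar> * ennreal \<bar>indicator A (z + h) - indicator A z\<bar> \<partial>lborel)"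
      by (intro nn_integral_cong) (auto simp: indicator_def)
    also have "\<dots> = ennreal \<bar>c\<bar> * (\<integral>\<^sup>+z. ennreal \<bar>indicator A (z + h) - indicator A z\<bar> \<partial>lborel)"
      by (intro nn_integral_cmult) auto
    also have "\<dots> \<le> ennreal \<bar>c\<bar> * ennreal (e / (\<bar>c\<bar> + 1))"
      using elim by (intro mult_left_mono) auto
    also have "\<dots> \<le> ennreal e"
      using base(3) by (simp flip: ennreal_mult add: field_simps)
    finally show ?case .
  qed
next
  case (add f g)
  have [measurable]: "f \<in> borel_measurable borel" "g \<in> borel_measurable borel"
    using add by auto
  have "\<forall>\<^sub>F h in nhds 0. (\<integral>\<^sup>+z. ennreal \<bar>f (z + h) - f z\<bar> \<partial>lborel) \<le> ennreal (e / 2)"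
    "\<forall>\<^sub>F h in nhds 0. (\<integral>\<^sup>+z. ennreal \<bar>g (z + h) - g z\<bar> \<partial>lborel) \<le> ennreal (e / 2)"
    using add by auto
  then show ?case
  proof eventually_elim
    case (elim h)
    have "(\<integral>\<^sup>+z. ennreal \<bar>f (z + h) + g (z + h) - (f z + g z)\<bar> \<partial>lborel) \<le>
       (\<integral>\<^sup>+z. ennreal \<bar>f (z + h) - f z\<bar> + ennreal \<bar>g (z + h) - g z\<bar> \<partial>lborel)"
      by (intro nn_integral_mono) (auto simp flip: ennreal_plus)
    also have "\<dots> = (\<integral>\<^sup>+z. ennreal \<bar>f (z + h) - f z\<bar> \<partial>lborel) + (\<integral>\<^sup>+z. ennreal \<bar>g (z + h) - g z\<bar> \<partial>lborel)"
      by (intro nn_integral_add) auto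
    also have "\<dots> \<le> ennreal (e / 2) + ennreal (e / 2)"
      using elim by (intro add_mono)
    also have "\<dots> = ennreal e"
      using add.prems by (simp flip: ennreal_plus)
    finally show ?case .
  qed
next
  case (lim f s)
  have [measurable]: "f \<in> borel_measurable borel" "\<And>i. s i \<in> borel_measurable borel"
    using lim by auto
  have "(\<lambda>i. \<integral>\<^sup>+z. ennreal (norm (f z - s i z)) \<partial>lborel) \<longlonglongrightarrow> 0"
    using lim
    by (intro nn_integral_dominated_convergence_norm[where w = "\<lambda>z. 2 * \<bar>f z\<bar>"])
       (auto simp: integrable_iff_bounded nn_integral_cmult ennreal_mult ennreal_mult_less_top)
  then have "\<forall>\<^sub>F i in sequentially. (\<integral>\<^sup>+z. ennreal (norm (f z - s i z)) \<partial>lborel) < ennreal (e / 4)"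
    using lim by (intro order_tendstoD) auto
  then obtain i where i: "(\<integral>\<^sup>+z. ennreal \<bar>f z - s i z\<bar> \<partial>lborel) < ennreal (e / 4)"
    using eventually_happens by force
  have "\<forall>\<^sub>F h in nhds 0. (\<integral>\<^sup>+z. ennreal \<bar>s i (z + h) - s i z\<bar> \<partial>lborel) \<le> ennreal (e / 2)"
    using lim by auto
  then show ?case
  proof eventually_elim
    case (elim h)
    have "(\<integral>\<^sup>+z. ennreal \<bar>f (z + h) - f z\<bar> \<partial>lborel) \<le>
       (\<integral>\<^sup>+z. (ennreal \<bar>f (z + h) - s i (z + h)\<bar> + ennreal \<bar>f z - s i z\<bar>) + ennreal \<bar>s i (z + h) - s i z\<bar> \<partial>lborel)"
      by (intro nn_integral_mono) (auto simp flip: ennreal_plus)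
    also have "\<dots> = ((\<integral>\<^sup>+z. ennreal \<bar>f (z + h) - s i (z + h)\<bar> \<partial>lborel) + (\<integral>\<^sup>+z. ennreal \<bar>f z - s i z\<bar> \<partial>lborel))
       + (\<integral>\<^sup>+z. ennreal \<bar>s i (z + h) - s i z\<bar> \<partial>lborel)"
      by (subst nn_integral_add; (subst nn_integral_add)?; simp)
    also have "(\<integral>\<^sup>+z. ennreal \<bar>f (z + h) - s i (z + h)\<bar> \<partial>lborel) = (\<integral>\<^sup>+z. ennreal \<bar>f z - s i z\<bar> \<partial>lborel)"
      by (rule nn_integral_lborel_translate) auto
    also have "(\<integral>\<^sup>+z. ennreal \<bar>f z - s i z\<bar> \<partial>lborel) + (\<integral>\<^sup>+z. ennreal \<bar>f z - s i z\<bar> \<partial>lborel)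
       + (\<integral>\<^sup>+z. ennreal \<bar>s i (z + h) - s i z\<bar> \<partial>lborel) \<le> (ennreal (e / 4) + ennreal (e / 4)) + ennreal (e / 2)"
      by (intro add_mono less_imp_le i elim)
    also have "\<dots> = ennreal e"
      using lim.prems by (simp flip: ennreal_plus)
    finally show ?case .
  qed
qed

subsection \<open>Square-integrable functions\<close>

lemma square_integrable_mult:
  fixes u v :: "'a \<Rightarrow> real"
  assumes [measurable]: "u \<in> borel_measurable M" "v \<in> borel_measurable M"
    and u: "integrable M (\<lambda>x. (u x)\<^sup>2)" and v: "integrable M (\<lambda>x. (v x)\<^sup>2)"
  shows "integrable M (\<lambda>x. u x * v x)"
proof (rule Bochner_Integration.integrable_bound)
  show "integrable M (\<lambda>x. (u x)\<^sup>2 + (v x)\<^sup>2)"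
    using u v by simp
  have "\<bar>a * b\<bar> \<le> a\<^sup>2 + b\<^sup>2" for a b :: real
    using sum_squares_bound[of "\<bar>a\<bar>" "\<bar>b\<bar>"] mult_nonneg_nonneg[of "\<bar>a\<bar>" "\<bar>b\<bar>"]
    by (simp add: abs_mult del: mult_nonneg_nonneg)
  then show "AE x in M. norm (u x * v x) \<le> norm ((u x)\<^sup>2 + (v x)\<^sup>2)"
    by simp
qed measurable

lemma Cauchy_Schwarz_integral:
  fixes u v :: "'a \<Rightarrow> real"
  assumes [measurable]: "u \<in> borel_measurable M" "v \<in> borel_measurable M"
    and u: "integrable M (\<lambda>x. (u x)\<^sup>2)" and v: "integrable M (\<lambda>x. (v x)\<^sup>2)"
  shows "\<bar>LINT x|M. u x * v x\<bar> \<le> sqrt (LINT x|M. (u x)\<^sup>2) * sqrt (LINT x|M. (v x)\<^sup>2)"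
proof -
  have uv: "integrable M (\<lambda>x. \<bar>u x\<bar> * \<bar>v x\<bar>)"
    using integrable_abs[OF square_integrable_mult[OF assms]] by (simp add: abs_mult)
  have "ennreal ((LINT x|M. \<bar>u x\<bar> * \<bar>v x\<bar>)\<^sup>2) = (\<integral>\<^sup>+x. ennreal \<bar>u x\<bar> * ennreal \<bar>v x\<bar> \<partial>M)\<^sup>2"
    using nn_integral_eq_integral[OF uv] by (simp add: ennreal_mult ennreal_power)
  also have "\<dots> \<le> (\<integral>\<^sup>+x. (ennreal \<bar>u x\<bar>)\<^sup>2 \<partial>M) * (\<integral>\<^sup>+x. (ennreal \<bar>v x\<bar>)\<^sup>2 \<partial>M)"
    by (rule Cauchy_Schwarz_nn_integral) auto
  also have "\<dots> = ennreal ((LINT x|M. (u x)\<^sup>2) * (LINT x|M. (v x)\<^sup>2))"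
    using nn_integral_eq_integral[OF u] nn_integral_eq_integral[OF v]
    by (simp add: ennreal_mult ennreal_power)
  finally have "(LINT x|M. \<bar>u x\<bar> * \<bar>v x\<bar>)\<^sup>2 \<le> (LINT x|M. (u x)\<^sup>2) * (LINT x|M. (v x)\<^sup>2)"
    by (subst (asm) ennreal_le_iff) (auto intro!: mult_nonneg_nonneg)
  then have "(LINT x|M. \<bar>u x\<bar> * \<bar>v x\<bar>) \<le> sqrt (LINT x|M. (u x)\<^sup>2) * sqrt (LINT x|M. (v x)\<^sup>2)"
    by (simp add: real_le_rsqrt flip: real_sqrt_mult)
  moreover have "\<bar>LINT x|M. u x * v x\<bar> \<le> (LINT x|M. \<bar>u x\<bar> * \<bar>v x\<bar>)"
    using integral_abs_bound[of M "\<lambda>x. u x * v x"] by (simp add: abs_mult)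
  ultimately show ?thesis by linarith
qed

text \<open>The remainder is 0 at x as soon as k reaches |F x|, and its square never exceeds that of
  F, so dominated convergence applies. Large values are set to 0 rather than clamped.\<close>

lemma L2_truncation_tendsto:
  fixes F :: "'a \<Rightarrow> real"
  assumes [measurable]: "F \<in> borel_measurable M" and F: "integrable M (\<lambda>x. (F x)\<^sup>2)"
  shows "(\<lambda>k. LINT x|M. (F x - (if \<bar>F x\<bar> \<le> real k then F x else 0))\<^sup>2) \<longlonglongrightarrow> 0"
proof -
  have "(\<lambda>k. LINT x|M. (F x - (if \<bar>F x\<bar> \<le> real k then F x else 0))\<^sup>2) \<longlonglongrightarrow> (LINT x|M. 0)"
  proof (rule integral_dominated_convergence[OF _ _ F])
    have "(\<lambda>k. (F x - (if \<bar>F x\<bar> \<le> real k then F x else 0))\<^sup>2) \<longlonglongrightarrow> 0" for x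
    proof (rule tendsto_eventually)
      show "\<forall>\<^sub>F k in sequentially. (F x - (if \<bar>F x\<bar> \<le> real k then F x else 0))\<^sup>2 = 0"
        using eventually_ge_at_top[of "nat \<lceil>\<bar>F x\<bar>\<rceil>"]
        by eventually_elim (auto simp: nat_le_iff ceiling_le_iff)
    qed
    then show "AE x in M. (\<lambda>k. (F x - (if \<bar>F x\<bar> \<le> real k then F x else 0))\<^sup>2) \<longlonglongrightarrow> 0"
      by simp
  qed auto
  then show ?thesis by simp
qed

subsection \<open>Correlations of Borel functions\<close>

text \<open>Periodicity is phrased through \<open>torus_reduce\<close> so that it directly absorbs
  the reduction contained in the shear. Borel measurability makes all sections and all composites
  with shears measurable, without exceptional sets.\<close>

definition torus_function :: "((real ^ 'n) \<times> (real ^ 'n) \<Rightarrow> real) \<Rightarrow> bool" where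
  "torus_function F \<longleftrightarrow>
    F \<in> borel_measurable phase_measure \<and> (\<forall>\<omega> x. F (\<omega>, torus_reduce x) = F (\<omega>, x))"

lemma torus_function_measurable: "torus_function F \<Longrightarrow> F \<in> borel_measurable phase_measure"
  and torus_function_reduce: "torus_function F \<Longrightarrow> F (\<omega>, torus_reduce x) = F (\<omega>, x)"
  by (simp_all add: torus_function_def)

text \<open>A periodic H does not see the reduction in the shear, so the change of variables of
  \<open>phase_measure_shear\<close> can be written with plain translations.\<close>

lemma phase_shift:
  fixes H :: "(real ^ 'n) \<times> (real ^ 'n) \<Rightarrow> real"
  assumes H: "torus_function H" and c: "c \<in> borel_measurable borel"
  shows "(LINT z|phase_measure. H (fst z + a, snd z + c (fst z))) = (LINT z|phase_measure. H z)"
    and "integrable phase_measure (\<lambda>z. H (fst z + a, snd z + c (fst z))) \<longleftrightarrow> integrable phase_measure H"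
proof -
  let ?S = "\<lambda>(\<omega>, x). (\<omega> + a, torus_reduce (x + c \<omega>))"
  note S = phase_measure_shear[OF c, of a]
  note [measurable] = torus_function_measurable[OF H] S(1)
  have eq: "H (?S z) = H (fst z + a, snd z + c (fst z))" for z
    by (simp add: case_prod_beta torus_function_reduce[OF H])
  show "(LINT z|phase_measure. H (fst z + a, snd z + c (fst z))) = (LINT z|phase_measure. H z)"
    using integral_distr[OF S(1), of H] by (simp add: S(2) eq)
  show "integrable phase_measure (\<lambda>z. H (fst z + a, snd z + c (fst z))) \<longleftrightarrow> integrable phase_measure H"
    using integrable_distr_eq[OF S(1), of H] by (simp add: S(2) eq)
qed

lemma nn_integral_phase_shift:
  fixes H :: "(real ^ 'n) \<times> (real ^ 'n) \<Rightarrow> ennreal"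
  assumes [measurable]: "H \<in> borel_measurable phase_measure"
    and inv: "\<And>\<omega> x. H (\<omega>, torus_reduce x) = H (\<omega>, x)" and c: "c \<in> borel_measurable borel"
  shows "(\<integral>\<^sup>+z. H (fst z + a, snd z + c (fst z)) \<partial>phase_measure) = (\<integral>\<^sup>+z. H z \<partial>phase_measure)"
proof -
  let ?S = "\<lambda>(\<omega>, x). (\<omega> + a, torus_reduce (x + c \<omega>))"
  note S = phase_measure_shear[OF c, of a]
  have eq: "H (?S z) = H (fst z + a, snd z + c (fst z))" for z
    by (simp add: case_prod_beta inv)
  show ?thesis
    using nn_integral_distr[OF S(1), of H] by (simp add: S(2) eq)
qed

lemma measurable_phase_shift:
  assumes "torus_function H" and [measurable]: "c \<in> borel_measurable borel"
  shows "(\<lambda>z. H (fst z + a, snd z + c (fst z))) \<in> borel_measurable phase_measure"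
proof -
  note [measurable] = torus_function_measurable[OF assms(1)]
  show ?thesis by measurable
qed

lemma torus_function_shift:
  assumes F: "torus_function F" and [measurable]: "c \<in> borel_measurable borel"
  shows "torus_function (\<lambda>z. F (fst z + a, snd z + c (fst z)))"
  unfolding torus_function_def
proof (intro conjI allI)
  show "(\<lambda>z. F (fst z + a, snd z + c (fst z))) \<in> borel_measurable phase_measure"
    by (rule measurable_phase_shift) fact+
  fix \<omega> x
  have "F (\<omega> + a, torus_reduce x + c \<omega>) = F (\<omega> + a, torus_reduce (torus_reduce x + c \<omega>))"
    by (simp add: torus_function_reduce[OF F])
  also have "\<dots> = F (\<omega> + a, x + c \<omega>)"
    by (simp add: torus_reduce_add torus_function_reduce[OF F])
  finally show "F (fst (\<omega>, torus_reduce x) + a, snd (\<omega>, torus_reduce x) + c (fst (\<omega>, torus_reduce x))) =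
      F (fst (\<omega>, x) + a, snd (\<omega>, x) + c (fst (\<omega>, x)))"
    by simp
qed

lemma torus_function_mult: "torus_function F \<Longrightarrow> torus_function G \<Longrightarrow> torus_function (\<lambda>z. F z * G z)"
  and torus_function_diff: "torus_function F \<Longrightarrow> torus_function G \<Longrightarrow> torus_function (\<lambda>z. F z - G z)"
  and torus_function_power2: "torus_function F \<Longrightarrow> torus_function (\<lambda>z. (F z)\<^sup>2)"
  and torus_function_truncate: "torus_function F \<Longrightarrow> torus_function (\<lambda>z. if \<bar>F z\<bar> \<le> k then F z else 0)"
  unfolding torus_function_def by auto

definition phase_correlation ::
  "((real ^ 'n) \<times> (real ^ 'n) \<Rightarrow> real) \<Rightarrow> ((real ^ 'n) \<times> (real ^ 'n) \<Rightarrow> real) \<Rightarrow> real \<Rightarrow> real" where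
  "phase_correlation F G t = (LINT z|phase_measure. F (fst z, snd z - t *\<^sub>R fst z) * G z)"

text \<open>The limit value in terms of unnormalised fibre integrals: two normalising factors of the
  means and the factor in front of the integral leave one division by the mass of the torus.\<close>

definition phase_mean_product ::
  "((real ^ 'n) \<times> (real ^ 'n) \<Rightarrow> real) \<Rightarrow> ((real ^ 'n) \<times> (real ^ 'n) \<Rightarrow> real) \<Rightarrow> real" where
  "phase_mean_product F G =
     (LINT \<omega>|lborel. (LINT x|torus_measure. F (\<omega>, x)) * (LINT x|torus_measure. G (\<omega>, x))) / (2 * pi) ^ CARD('n)"

definition phase_norm :: "((real ^ 'n) \<times> (real ^ 'n) \<Rightarrow> real) \<Rightarrow> real" where
  "phase_norm F = sqrt (LINT z|phase_measure. (F z)\<^sup>2)"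

definition L2_torus_function :: "((real ^ 'n) \<times> (real ^ 'n) \<Rightarrow> real) \<Rightarrow> bool" where
  "L2_torus_function F \<longleftrightarrow> torus_function F \<and> integrable phase_measure (\<lambda>z. (F z)\<^sup>2)"

text \<open>The shear preserves the L2 norm of F, so the Cauchy-Schwarz bound does not depend on c.
  With \<open>c \<omega> = - t *\<^sub>R \<omega>\<close> this is the uniformity in t on which the
  truncation argument rests.\<close>

lemma phase_correlation_shift:
  assumes F: "L2_torus_function F" and G: "L2_torus_function G" and [measurable]: "c \<in> borel_measurable borel"
  shows "integrable phase_measure (\<lambda>z. F (fst z, snd z + c (fst z)) * G z)" (is ?I)
    and "\<bar>LINT z|phase_measure. F (fst z, snd z + c (fst z)) * G z\<bar> \<le> phase_norm F * phase_norm G" (is ?B)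
proof -
  have F': "torus_function F" and G': "torus_function G"
    using F G by (auto simp: L2_torus_function_def)
  note [measurable] = torus_function_measurable[OF G'] torus_function_measurable[OF F']
  note F2 = phase_shift[OF torus_function_power2[OF F'] assms(3), of 0, simplified]
  have sq: "integrable phase_measure (\<lambda>z. (F (fst z, snd z + c (fst z)))\<^sup>2)"
    using F unfolding F2 by (simp add: L2_torus_function_def)
  have sq': "integrable phase_measure (\<lambda>z. (G z)\<^sup>2)"
    using G by (simp add: L2_torus_function_def)
  show ?I
    by (rule square_integrable_mult[OF _ _ sq sq']) measurable
  show ?B
    using Cauchy_Schwarz_integral[OF _ _ sq sq'] unfolding F2 phase_norm_def by simp
qed

section \<open>Averaging correlations over the phase\<close>

lemma lint_torus_translate:
  fixes h :: "real ^ 'n \<Rightarrow> real"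
  assumes [measurable]: "h \<in> borel_measurable borel" and inv: "\<And>x. h (torus_reduce x) = h x"
  shows "(LINT x|torus_measure. h (y + x)) = (LINT x|torus_measure. h x)"
proof -
  have "distr torus_measure borel (\<lambda>x. torus_reduce (x + y)) = torus_measure"
  proof (rule measure_eqI)
    fix A assume "A \<in> sets (distr torus_measure borel (\<lambda>x. torus_reduce (x + y)))"
    then have [measurable]: "A \<in> sets borel" by simp
    show "emeasure (distr torus_measure borel (\<lambda>x. torus_reduce (x + y))) A = emeasure torus_measure A"
      using nn_integral_torus_translate[of "indicator A" y]
      by (subst (1 2) nn_integral_indicator[symmetric]) (simp_all add: nn_integral_distr del: nn_integral_indicator)
  qed simp
  moreover have "(LINT x|distr torus_measure borel (\<lambda>x. torus_reduce (x + y)). h x) =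
      (LINT x|torus_measure. h (torus_reduce (x + y)))"
    by (intro integral_distr) measurable
  ultimately show ?thesis
    by (simp add: inv add.commute)
qed

interpretation phase_torus: pair_sigma_finite phase_measure torus_measure
  unfolding pair_sigma_finite_def using phase.P.sigma_finite_measure_axioms torus.sigma_finite_measure_axioms by simp

lemma L2_torus_function_D:
  assumes "L2_torus_function F"
  shows "torus_function F" "F \<in> borel_measurable phase_measure" "integrable phase_measure (\<lambda>z. (F z)\<^sup>2)"
    "F (\<omega>, torus_reduce x) = F (\<omega>, x)"
  using assms by (auto simp: L2_torus_function_def torus_function_def)

text \<open>By Tonelli the total L1 norm is C times the mass of Q. This supplies joint integrability
  once the auxiliary phase v is added as a further variable.\<close>

lemma integrable_finite_measure_fibres:
  fixes u :: "'a \<times> 'b \<Rightarrow> real"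
  assumes "sigma_finite_measure M" "finite_measure Q"
    and [measurable]: "u \<in> borel_measurable (M \<Otimes>\<^sub>M Q)"
    and eq: "\<And>v. (\<integral>\<^sup>+z. ennreal \<bar>u (z, v)\<bar> \<partial>M) = C" and C: "C < \<infinity>"
  shows "integrable (M \<Otimes>\<^sub>M Q) u"
proof -
  interpret M: sigma_finite_measure M by fact
  interpret Q: finite_measure Q by fact
  interpret MQ: pair_sigma_finite M Q ..
  have "(\<integral>\<^sup>+w. ennreal \<bar>u w\<bar> \<partial>(M \<Otimes>\<^sub>M Q)) = (\<integral>\<^sup>+v. \<integral>\<^sup>+z. ennreal \<bar>u (z, v)\<bar> \<partial>M \<partial>Q)"
    by (rule MQ.nn_integral_snd[symmetric]) measurable
  then have *: "(\<integral>\<^sup>+w. ennreal \<bar>u w\<bar> \<partial>(M \<Otimes>\<^sub>M Q)) = C * emeasure Q (space Q)"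
    by (simp add: eq)
  have "C * emeasure Q (space Q) < \<infinity>"
    using C by (simp add: ennreal_mult_eq_top_iff less_top[symmetric])
  with * show "integrable (M \<Otimes>\<^sub>M Q) u"
    by (simp add: integrable_iff_bounded)
qed

text \<open>Fubini in (\<omega>, x, v). Integrating over v first, translation invariance removes the
  offset \<open>snd z + c (fst z)\<close> and leaves the fibre integral of F, so the result is
  independent of c, hence of t. Joint integrability of the product follows from that of the two
  squares.\<close>

lemma phase_average:
  fixes F G :: "(real ^ 'n) \<times> (real ^ 'n) \<Rightarrow> real"
  assumes F: "L2_torus_function F" and G: "L2_torus_function G"
    and c [measurable]: "c \<in> borel_measurable borel"
  defines "L \<equiv> \<lambda>v. LINT z|phase_measure. F (fst z, snd z + c (fst z) + v) * G z"
  shows "integrable torus_measure L"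
    and "(LINT v|torus_measure. L v) = (2 * pi) ^ CARD('n) * phase_mean_product F G"
    and "integrable lborel (\<lambda>\<omega>. (LINT x|torus_measure. F (\<omega>, x)) * (LINT x|torus_measure. G (\<omega>, x)))"
proof -
  note [measurable] = L2_torus_function_D(2)[OF F] L2_torus_function_D(2)[OF G]
  let ?u = "\<lambda>(z, v). F (fst z, snd z + c (fst z) + v)" and ?w = "\<lambda>(z, v). G z"
  have [measurable]: "?u \<in> borel_measurable (phase_measure \<Otimes>\<^sub>M torus_measure)"
    "?w \<in> borel_measurable (phase_measure \<Otimes>\<^sub>M torus_measure)"
    by measurable
  have u: "integrable (phase_measure \<Otimes>\<^sub>M torus_measure) (\<lambda>p. (?u p)\<^sup>2)"
  proof (rule integrable_finite_measure_fibres)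
    fix v
    show "(\<integral>\<^sup>+z. ennreal \<bar>(?u (z, v))\<^sup>2\<bar> \<partial>phase_measure) = (\<integral>\<^sup>+z. ennreal ((F z)\<^sup>2) \<partial>phase_measure)"
      using nn_integral_phase_shift[of "\<lambda>z. ennreal ((F z)\<^sup>2)" "\<lambda>\<omega>. c \<omega> + v" 0] L2_torus_function_D(4)[OF F]
      by (simp add: add.assoc)
  qed (use L2_torus_function_D(3)[OF F] phase.P.sigma_finite_measure_axioms finite_torus_measure
      in \<open>auto simp: integrable_iff_bounded\<close>)
  have w: "integrable (phase_measure \<Otimes>\<^sub>M torus_measure) (\<lambda>p. (?w p)\<^sup>2)"
    by (rule integrable_finite_measure_fibres)
      (use L2_torus_function_D(3)[OF G] phase.P.sigma_finite_measure_axioms finite_torus_measure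
      in \<open>auto simp: integrable_iff_bounded\<close>)
  have uw: "integrable (phase_measure \<Otimes>\<^sub>M torus_measure) (\<lambda>p. ?u p * ?w p)"
    by (rule square_integrable_mult[OF _ _ u w]) measurable
  then have uw': "integrable (phase_measure \<Otimes>\<^sub>M torus_measure) (\<lambda>(z, v). F (fst z, snd z + c (fst z) + v) * G z)"
    by (simp add: case_prod_unfold)
  show "integrable torus_measure L"
    unfolding L_def by (rule phase_torus.integrable_snd[OF uw'])
  have inner: "(LINT v|torus_measure. F (fst z, snd z + c (fst z) + v)) =
      (LINT x|torus_measure. F (fst z, x))" for z :: "(real ^ 'n) \<times> (real ^ 'n)"
    using lint_torus_translate[of "\<lambda>x. F (fst z, x)" "snd z + c (fst z)"] L2_torus_function_D(4)[OF F]
    by simp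
  have fst_int: "integrable phase_measure (\<lambda>(\<omega>, x'). (LINT x|torus_measure. F (\<omega>, x)) * G (\<omega>, x'))"
    using phase_torus.integrable_fst[OF uw'] by (simp add: inner case_prod_unfold)
  show "integrable lborel (\<lambda>\<omega>. (LINT x|torus_measure. F (\<omega>, x)) * (LINT x|torus_measure. G (\<omega>, x)))"
    using phase.integrable_fst[OF fst_int] by simp
  have "(LINT v|torus_measure. L v) = (LINT z|phase_measure. (LINT x|torus_measure. F (fst z, x)) * G z)"
    unfolding L_def using phase_torus.Fubini_integral[OF uw'] by (simp add: inner)
  also have "\<dots> = (LINT \<omega>|lborel. (LINT x|torus_measure. F (\<omega>, x)) * (LINT x|torus_measure. G (\<omega>, x)))"
    using phase.integral_fst[OF fst_int] by (simp add: case_prod_unfold)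
  finally show "(LINT v|torus_measure. L v) = (2 * pi) ^ CARD('n) * phase_mean_product F G"
    by (simp add: phase_mean_product_def)
qed

text \<open>Up to the mass of the torus, the mean product is the integral over v of correlations
  with constant shift v, and each of these obeys the Cauchy-Schwarz bound.\<close>

lemma phase_mean_product_bound:
  fixes F G :: "(real ^ 'n) \<times> (real ^ 'n) \<Rightarrow> real"
  assumes F: "L2_torus_function F" and G: "L2_torus_function G"
  shows "\<bar>phase_mean_product F G\<bar> \<le> phase_norm F * phase_norm G"
proof -
  let ?m = "(2 * pi) ^ CARD('n) :: real"
  let ?L = "\<lambda>v. LINT z|phase_measure. F (fst z, snd z + 0 + v) * G z"
  note av = phase_average[OF F G, of "\<lambda>_. 0", OF borel_measurable_const]
  have "\<bar>LINT v|torus_measure. ?L v\<bar> \<le> (LINT v|torus_measure. \<bar>?L v\<bar>)"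
    by (rule integral_abs_bound)
  also have "\<dots> \<le> (LINT v|(torus_measure :: (real ^ 'n) measure). phase_norm F * phase_norm G)"
    using phase_correlation_shift(2)[OF F G borel_measurable_const] av(1)
    by (intro integral_mono integrable_abs) auto
  also have "\<dots> = ?m * (phase_norm F * phase_norm G)"
    by (simp add: measure_torus_measure_UNIV)
  finally have "?m * \<bar>phase_mean_product F G\<bar> \<le> ?m * (phase_norm F * phase_norm G)"
    unfolding av(2) by (simp add: abs_mult)
  then show ?thesis
    by (rule mult_left_le_imp_le) simp
qed

section \<open>Small frequency shifts and the bounded case\<close>

lemma indicator_UNIV_times: "indicator (UNIV \<times> A) z = indicator A (snd z)"
  by (auto simp: indicator_def mem_Times_iff)

lemma sets_UNIV_times_torus_cell [measurable]:
  "(UNIV :: (real ^ 'n) set) \<times> (torus_cell :: (real ^ 'n) set) \<in> sets borel"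
proof -
  have "(UNIV :: (real ^ 'n) set) \<times> (torus_cell :: (real ^ 'n) set) \<in> sets (borel \<Otimes>\<^sub>M borel)"
    by measurable
  then show ?thesis
    by (simp only: borel_prod)
qed

text \<open>This form connects the product measure with results about Lebesgue measure on the whole
  space: translation continuity and the transfer from \<open>lebesgue\<close>.\<close>

lemma phase_measure_density:
  "(phase_measure :: ((real ^ 'n) \<times> (real ^ 'n)) measure) = density lborel (indicator (UNIV \<times> torus_cell))"
proof (rule measure_eqI)
  show "sets (phase_measure :: ((real ^ 'n) \<times> (real ^ 'n)) measure) = sets (density lborel (indicator (UNIV \<times> torus_cell)))"
    by (simp only: sets_phase_measure sets_density sets_lborel)
  fix A :: "((real ^ 'n) \<times> (real ^ 'n)) set"
  assume A [measurable]: "A \<in> sets phase_measure"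
  then have A': "A \<in> sets borel" by (simp only: sets_phase_measure)
  have m1: "(indicator A :: _ \<Rightarrow> ennreal) \<in> borel_measurable (lborel \<Otimes>\<^sub>M lborel)"
    using A' by (intro borel_measurable_indicator) (simp only: lborel_prod sets_lborel)
  have m2: "(\<lambda>z. indicator torus_cell (snd z) :: ennreal) \<in> borel_measurable (lborel \<Otimes>\<^sub>M lborel)"
    by (rule measurable_compose[OF measurable_snd borel_measurable_indicator]) simp
  have "emeasure phase_measure A = (\<integral>\<^sup>+\<omega>. \<integral>\<^sup>+x. indicator A (\<omega>, x) \<partial>torus_measure \<partial>lborel)"
    by (rule torus.emeasure_pair_measure) fact
  also have "\<dots> = (\<integral>\<^sup>+\<omega>. \<integral>\<^sup>+x. indicator A (\<omega>, x) * indicator torus_cell x \<partial>lborel \<partial>lborel)"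
    by (intro nn_integral_cong nn_integral_torus_measure) measurable
  also have "\<dots> = (\<integral>\<^sup>+z. indicator A z * indicator torus_cell (snd z) \<partial>(lborel \<Otimes>\<^sub>M lborel))"
    using lborel.nn_integral_fst[OF borel_measurable_times_ennreal[OF m1 m2]] by simp
  also have "\<dots> = emeasure (density lborel (indicator (UNIV \<times> torus_cell))) A"
    using A' by (simp add: lborel_prod emeasure_density indicator_UNIV_times mult.commute)
  finally show "emeasure phase_measure A = emeasure (density lborel (indicator (UNIV \<times> torus_cell))) A" .
qed

text \<open>The displacement (a, 0) leaves x fixed, so cutting F off outside the cell commutes with
  it and yields an integrable function on the whole space.\<close>

lemma frequency_translation_continuous:
  fixes F :: "(real ^ 'n) \<times> (real ^ 'n) \<Rightarrow> real"
  assumes F: "integrable phase_measure F" and e: "0 < e"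
  shows "\<forall>\<^sub>F a in nhds 0. (\<integral>\<^sup>+z. ennreal \<bar>F (fst z + a, snd z) - F z\<bar> \<partial>phase_measure) \<le> ennreal e"
proof -
  let ?f = "\<lambda>z. indicator (UNIV \<times> torus_cell) z * F z"
  have F_meas [measurable]: "F \<in> borel_measurable borel"
    using F by (metis borel_measurable_integrable measurable_cong_sets sets_phase_measure)
  have "integrable (density lborel (\<lambda>z. ennreal (indicator (UNIV \<times> torus_cell) z))) F"
    using F unfolding phase_measure_density by (simp add: ennreal_indicator)
  then have f: "integrable lborel ?f"
    by (subst (asm) integrable_density) auto
  have "((\<lambda>a :: real ^ 'n. (a, 0 :: real ^ 'n)) \<longlongrightarrow> (0, 0)) (nhds 0)"
    by (intro tendsto_intros filterlim_ident)
  then have "filterlim (\<lambda>a :: real ^ 'n. (a, 0 :: real ^ 'n)) (nhds 0) (nhds 0)"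
    by (simp add: zero_prod_def)
  from eventually_compose_filterlim[OF L1_translation_continuous[OF f e] this]
  show ?thesis
  proof eventually_elim
    case (elim a)
    have [measurable]: "(\<lambda>z. F (fst z + a, snd z)) \<in> borel_measurable borel"
      by (rule measurable_compose[OF _ F_meas]) (intro borel_measurable_continuous_onI continuous_intros)
    have "(\<integral>\<^sup>+z. ennreal \<bar>F (fst z + a, snd z) - F z\<bar> \<partial>phase_measure) =
        (\<integral>\<^sup>+z. indicator (UNIV \<times> torus_cell) z * ennreal \<bar>F (fst z + a, snd z) - F z\<bar> \<partial>lborel)"
      unfolding phase_measure_density by (rule nn_integral_density) auto
    also have "\<dots> = (\<integral>\<^sup>+z. ennreal \<bar>?f (z + (a, 0)) - ?f z\<bar> \<partial>lborel)"
      by (intro nn_integral_cong) (auto simp: indicator_def plus_prod_def)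
    finally show ?case
      using elim by simp
  qed
qed

lemma correlation_frequency_shift:
  fixes F G :: "(real ^ 'n) \<times> (real ^ 'n) \<Rightarrow> real"
  assumes F: "L2_torus_function F" and G: "L2_torus_function G"
    and B: "\<And>z. \<bar>F z\<bar> \<le> B" "\<And>z. \<bar>G z\<bar> \<le> B"
    and a: "t *\<^sub>R a = - v" and e: "0 \<le> e"
    and DF: "(\<integral>\<^sup>+z. ennreal \<bar>F (fst z + a, snd z) - F z\<bar> \<partial>phase_measure) \<le> ennreal e"
    and DG: "(\<integral>\<^sup>+z. ennreal \<bar>G (fst z + a, snd z) - G z\<bar> \<partial>phase_measure) \<le> ennreal e"
  shows "\<bar>phase_correlation F G t - (LINT z|phase_measure. F (fst z, snd z + - t *\<^sub>R fst z + v) * G z)\<bar> \<le> 2 * B * e"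
proof -
  note F' = L2_torus_function_D(1)[OF F] and G' = L2_torus_function_D(1)[OF G]
  note [measurable] = L2_torus_function_D(2)[OF F] L2_torus_function_D(2)[OF G]
  have B0: "0 \<le> B" using B(1)[of undefined] by linarith
  \<comment> \<open>\<open>?X\<close> is \<open>?H\<close> after the substitution of \<omega> + a
    for \<omega>, where \<open>t *\<^sub>R a = - v\<close> produces the phase v; \<open>?Y\<close>
    drops the remaining shifts by a.\<close>
  let ?H = "\<lambda>z. F (fst z, snd z - t *\<^sub>R fst z) * G z"
  let ?X = "\<lambda>z. F (fst z + a, snd z + (- t *\<^sub>R fst z + v)) * G (fst z + a, snd z)"
  let ?Y = "\<lambda>z. F (fst z, snd z + (- t *\<^sub>R fst z + v)) * G z"
  have H: "torus_function ?H"
    using torus_function_mult[OF torus_function_shift[OF F', of "\<lambda>\<omega>. - t *\<^sub>R \<omega>" 0] G'] by simp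
  have H_int: "integrable phase_measure ?H"
    using phase_correlation_shift(1)[OF F G, of "\<lambda>\<omega>. - t *\<^sub>R \<omega>"] by simp
  have X_eq: "?H (fst z + a, snd z + 0) = ?X z" for z
    using a by (simp add: scaleR_add_right algebra_simps)
  have X: "integrable phase_measure ?X" "phase_correlation F G t = integral\<^sup>L phase_measure ?X"
    using phase_shift[OF H, of "\<lambda>_. 0" a] H_int
    unfolding X_eq by (simp_all add: phase_correlation_def)
  have Y: "integrable phase_measure ?Y"
    using phase_correlation_shift(1)[OF F G, of "\<lambda>\<omega>. - t *\<^sub>R \<omega> + v"] by simp
  \<comment> \<open>The difference of F is itself periodic, so measure preservation removes the
    shear; this makes the estimate uniform in t and v.\<close>
  have dF: "(\<integral>\<^sup>+z. ennreal \<bar>F (fst z + a, snd z + (- t *\<^sub>R fst z + v)) - F (fst z, snd z + (- t *\<^sub>R fst z + v))\<bar>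
      \<partial>phase_measure) = (\<integral>\<^sup>+z. ennreal \<bar>F (fst z + a, snd z) - F z\<bar> \<partial>phase_measure)"
    using nn_integral_phase_shift[of "\<lambda>z. ennreal \<bar>F (fst z + a, snd z) - F z\<bar>" "\<lambda>\<omega>. - t *\<^sub>R \<omega> + v" 0]
      L2_torus_function_D(4)[OF F] by simp
  have "ennreal \<bar>LINT z|phase_measure. ?X z - ?Y z\<bar> \<le> (\<integral>\<^sup>+z. ennreal \<bar>?X z - ?Y z\<bar> \<partial>phase_measure)"
    using integral_norm_bound_ennreal[OF Bochner_Integration.integrable_diff[OF X(1) Y]] by simp
  also have "\<dots> \<le> (\<integral>\<^sup>+z. ennreal B * ennreal \<bar>F (fst z + a, snd z + (- t *\<^sub>R fst z + v)) - F (fst z, snd z + (- t *\<^sub>R fst z + v))\<bar>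
      + ennreal B * ennreal \<bar>G (fst z + a, snd z) - G z\<bar> \<partial>phase_measure)"
  proof (rule nn_integral_mono)
    fix z
    let ?f1 = "F (fst z + a, snd z + (- t *\<^sub>R fst z + v))" and ?f0 = "F (fst z, snd z + (- t *\<^sub>R fst z + v))"
      and ?g1 = "G (fst z + a, snd z)" and ?g0 = "G z"
    have "\<bar>p * q - p' * q'\<bar> \<le> \<bar>p - p'\<bar> * \<bar>q\<bar> + \<bar>p'\<bar> * \<bar>q - q'\<bar>" for p p' q q' :: real
    proof -
      have eq: "p * q - p' * q' = (p - p') * q + p' * (q - q')"
        by (simp add: algebra_simps)
      show ?thesis
        unfolding eq abs_mult[symmetric] by (rule abs_triangle_ineq)
    qed
    then have "\<bar>?f1 * ?g1 - ?f0 * ?g0\<bar> \<le> \<bar>?f1 - ?f0\<bar> * \<bar>?g1\<bar> + \<bar>?f0\<bar> * \<bar>?g1 - ?g0\<bar>" .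
    also have "\<dots> \<le> \<bar>?f1 - ?f0\<bar> * B + B * \<bar>?g1 - ?g0\<bar>"
      by (intro add_mono mult_left_mono mult_right_mono B) auto
    finally show "ennreal \<bar>?f1 * ?g1 - ?f0 * ?g0\<bar> \<le> ennreal B * ennreal \<bar>?f1 - ?f0\<bar> + ennreal B * ennreal \<bar>?g1 - ?g0\<bar>"
      using B0 by (simp add: mult.commute flip: ennreal_mult ennreal_plus)
  qed
  also have "\<dots> = ennreal B * (\<integral>\<^sup>+z. ennreal \<bar>F (fst z + a, snd z) - F z\<bar> \<partial>phase_measure)
      + ennreal B * (\<integral>\<^sup>+z. ennreal \<bar>G (fst z + a, snd z) - G z\<bar> \<partial>phase_measure)"
    using dF by (subst nn_integral_add) (auto simp: nn_integral_cmult)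
  also have "\<dots> \<le> ennreal B * ennreal e + ennreal B * ennreal e"
    by (intro add_mono mult_left_mono DF DG) auto
  also have "\<dots> = ennreal (2 * B * e)"
    using B0 e by (simp flip: ennreal_mult ennreal_plus)
  finally have "\<bar>LINT z|phase_measure. ?X z - ?Y z\<bar> \<le> 2 * B * e"
    using B0 e by (subst (asm) ennreal_le_iff) auto
  then show ?thesis
    unfolding X(2) Bochner_Integration.integral_diff[OF X(1) Y] by (simp only: add.assoc)
qed

lemma AE_torus_cell: "AE x in torus_measure. x \<in> torus_cell"
  unfolding torus_measure_def by (subst AE_density) (auto simp: indicator_def)

lemma correlation_tendsto_bounded:
  fixes F G :: "(real ^ 'n) \<times> (real ^ 'n) \<Rightarrow> real"
  assumes F: "L2_torus_function F" and G: "L2_torus_function G"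
    and B: "\<And>z. \<bar>F z\<bar> \<le> B" "\<And>z. \<bar>G z\<bar> \<le> B"
    and int: "integrable phase_measure F" "integrable phase_measure G"
  shows "(phase_correlation F G \<longlongrightarrow> phase_mean_product F G) at_infinity"
proof (rule tendstoI)
  fix e :: real assume e: "0 < e"
  let ?m = "(2 * pi) ^ CARD('n) :: real"
  have B0: "0 \<le> B" using B(1)[of undefined] by linarith
  \<comment> \<open>Chosen so that the error \<open>2 * B * d\<close> of the frequency shift is at
    most e/2, also for B = 0.\<close>
  define d where "d = e / (4 * (B + 1))"
  have d: "0 < d" "2 * B * d \<le> e / 2"
    using e B0 by (auto simp: d_def field_simps)
  have "\<forall>\<^sub>F a in nhds 0. (\<integral>\<^sup>+z. ennreal \<bar>F (fst z + a, snd z) - F z\<bar> \<partial>phase_measure) \<le> ennreal d \<and>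
      (\<integral>\<^sup>+z. ennreal \<bar>G (fst z + a, snd z) - G z\<bar> \<partial>phase_measure) \<le> ennreal d"
    using int d by (intro eventually_conj frequency_translation_continuous)
  then obtain r where r: "0 < r"
    and DF: "\<And>a. norm a < r \<Longrightarrow> (\<integral>\<^sup>+z. ennreal \<bar>F (fst z + a, snd z) - F z\<bar> \<partial>phase_measure) \<le> ennreal d"
    and DG: "\<And>a. norm a < r \<Longrightarrow> (\<integral>\<^sup>+z. ennreal \<bar>G (fst z + a, snd z) - G z\<bar> \<partial>phase_measure) \<le> ennreal d"
    unfolding eventually_nhds_metric by auto
  obtain R where R: "0 < R" "\<And>v :: real ^ 'n. v \<in> torus_cell \<Longrightarrow> norm v \<le> R"
    using bounded_torus_cell unfolding bounded_pos by blast
  \<comment> \<open>Beyond this threshold t is nonzero and v/t is shorter than r for every v in the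
    cell at once.\<close>
  have "\<forall>\<^sub>F t :: real in at_infinity. R / r + 1 \<le> norm t"
    unfolding eventually_at_infinity by blast
  then show "\<forall>\<^sub>F t in at_infinity. dist (phase_correlation F G t) (phase_mean_product F G) < e"
  proof eventually_elim
    case (elim t)
    have "0 < R / r" using R r by simp
    then have t: "R / r < \<bar>t\<bar>" "t \<noteq> 0" using elim by auto
    let ?K = "phase_correlation F G t"
    let ?L = "\<lambda>v. LINT z|phase_measure. F (fst z, snd z + - t *\<^sub>R fst z + v) * G z"
    have c: "(\<lambda>\<omega> :: real ^ 'n. - t *\<^sub>R \<omega>) \<in> borel_measurable borel" by simp
    note av = phase_average[OF F G c]
    have near: "\<bar>?K - ?L v\<bar> \<le> e / 2" if v: "v \<in> torus_cell" for v
    proof -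
      have "norm (- (1 / t) *\<^sub>R v) = norm v / \<bar>t\<bar>"
        by simp
      also have "\<dots> \<le> R / \<bar>t\<bar>"
        using R(2)[OF v] by (intro divide_right_mono) auto
      also have "\<dots> < r"
        using t r by (simp add: field_simps)
      finally have "norm (- (1 / t) *\<^sub>R v) < r" .
      from correlation_frequency_shift[OF F G B _ _ DF[OF this] DG[OF this], of t v]
      show ?thesis using t d by simp
    qed
    \<comment> \<open>\<open>?K\<close> is constant in v, so the integral on the left is
      \<open>?m\<close> times the difference between the correlation and its claimed limit.\<close>
    have "\<bar>LINT v|torus_measure. ?K - ?L v\<bar> \<le> (LINT v|torus_measure. \<bar>?K - ?L v\<bar>)"
      by (rule integral_abs_bound)
    also have "\<dots> \<le> (LINT v|(torus_measure :: (real ^ 'n) measure). e / 2)"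
    proof (rule integral_mono_AE)
      show "AE v in torus_measure. \<bar>?K - ?L v\<bar> \<le> e / 2"
        using AE_torus_cell near by (auto intro: AE_mp)
    qed (use av(1) in auto)
    also have "\<dots> = ?m * (e / 2)"
      by (simp add: measure_torus_measure_UNIV)
    also have "(LINT v|torus_measure. ?K - ?L v) = ?m * ?K - (LINT v|torus_measure. ?L v)"
      using av(1) by (subst Bochner_Integration.integral_diff) (auto simp: measure_torus_measure_UNIV)
    also have "\<dots> = ?m * (?K - phase_mean_product F G)"
      by (simp only: av(2) right_diff_distrib)
    finally have "?m * \<bar>?K - phase_mean_product F G\<bar> \<le> ?m * (e / 2)"
      by (simp add: abs_mult)
    then have "\<bar>?K - phase_mean_product F G\<bar> \<le> e / 2"
      by (rule mult_left_le_imp_le) simp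
    then show ?case
      using e by (simp add: dist_real_def)
  qed
qed

section \<open>Reduction to bounded functions\<close>

lemma phase_norm_nonneg: "0 \<le> phase_norm F"
  by (simp add: phase_norm_def)

lemma L2_torus_function_diff:
  assumes "L2_torus_function F" "L2_torus_function G"
  shows "L2_torus_function (\<lambda>z. F z - G z)"
proof -
  note [measurable] = L2_torus_function_D(2)[OF assms(1)] L2_torus_function_D(2)[OF assms(2)]
  have "integrable phase_measure (\<lambda>z. F z * G z)"
    using assms by (intro square_integrable_mult L2_torus_function_D)
  then show ?thesis
    using assms by (auto simp: L2_torus_function_def torus_function_diff power2_diff mult.assoc)
qed

lemma L2_torus_function_truncate:
  assumes "L2_torus_function F"
  shows "L2_torus_function (\<lambda>z. if \<bar>F z\<bar> \<le> k then F z else 0)"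
    and "phase_norm (\<lambda>z. if \<bar>F z\<bar> \<le> k then F z else 0) \<le> phase_norm F"
proof -
  note [measurable] = L2_torus_function_D(2)[OF assms]
  have "integrable phase_measure (\<lambda>z. (if \<bar>F z\<bar> \<le> k then F z else 0)\<^sup>2)"
    by (rule Bochner_Integration.integrable_bound[OF L2_torus_function_D(3)[OF assms]]) auto
  then show "L2_torus_function (\<lambda>z. if \<bar>F z\<bar> \<le> k then F z else 0)"
    "phase_norm (\<lambda>z. if \<bar>F z\<bar> \<le> k then F z else 0) \<le> phase_norm F"
    using assms by (auto simp: L2_torus_function_def torus_function_truncate phase_norm_def
        intro!: integral_mono)
qed

text \<open>The difference splits as b(F - F', G) + b(F', G - G'). One estimate thus serves the
  correlation at every t and the mean product; the comparison of norms keeps F' out of the second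
  coefficient.\<close>

lemma bilinear_perturbation:
  fixes b :: "((real ^ 'n) \<times> (real ^ 'n) \<Rightarrow> real) \<Rightarrow> ((real ^ 'n) \<times> (real ^ 'n) \<Rightarrow> real) \<Rightarrow> real"
  assumes bound: "\<And>F G. L2_torus_function F \<Longrightarrow> L2_torus_function G \<Longrightarrow> \<bar>b F G\<bar> \<le> phase_norm F * phase_norm G"
    and left: "\<And>F F' G. L2_torus_function F \<Longrightarrow> L2_torus_function F' \<Longrightarrow> L2_torus_function G \<Longrightarrow>
      b (\<lambda>z. F z - F' z) G = b F G - b F' G"
    and right: "\<And>F G G'. L2_torus_function F \<Longrightarrow> L2_torus_function G \<Longrightarrow> L2_torus_function G' \<Longrightarrow>
      b F (\<lambda>z. G z - G' z) = b F G - b F G'"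
    and F: "L2_torus_function F" "L2_torus_function F'" and G: "L2_torus_function G" "L2_torus_function G'"
    and le: "phase_norm F' \<le> phase_norm F"
  shows "\<bar>b F G - b F' G'\<bar> \<le>
    phase_norm (\<lambda>z. F z - F' z) * phase_norm G + phase_norm F * phase_norm (\<lambda>z. G z - G' z)"
proof -
  have "b F G - b F' G' = b (\<lambda>z. F z - F' z) G + b F' (\<lambda>z. G z - G' z)"
    using F G by (simp add: left right)
  also have "\<bar>\<dots>\<bar> \<le> phase_norm (\<lambda>z. F z - F' z) * phase_norm G + phase_norm F' * phase_norm (\<lambda>z. G z - G' z)"
    by (intro order_trans[OF abs_triangle_ineq] add_mono bound L2_torus_function_diff F G)
  also have "\<dots> \<le> phase_norm (\<lambda>z. F z - F' z) * phase_norm G + phase_norm F * phase_norm (\<lambda>z. G z - G' z)"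
    by (intro add_left_mono mult_right_mono le phase_norm_nonneg)
  finally show ?thesis .
qed

lemma phase_correlation_diff:
  assumes "L2_torus_function F" "L2_torus_function F'" "L2_torus_function G" "L2_torus_function G'"
  shows "phase_correlation (\<lambda>z. F z - F' z) G t = phase_correlation F G t - phase_correlation F' G t"
    and "phase_correlation F (\<lambda>z. G z - G' z) t = phase_correlation F G t - phase_correlation F G' t"
proof -
  have int: "integrable phase_measure (\<lambda>z. F (fst z, snd z - t *\<^sub>R fst z) * G z)"
    if "L2_torus_function F" "L2_torus_function G" for F G :: "(real ^ 'n) \<times> (real ^ 'n) \<Rightarrow> real"
    using phase_correlation_shift(1)[OF that, of "\<lambda>\<omega>. - t *\<^sub>R \<omega>"] by simp
  show "phase_correlation (\<lambda>z. F z - F' z) G t = phase_correlation F G t - phase_correlation F' G t"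
    "phase_correlation F (\<lambda>z. G z - G' z) t = phase_correlation F G t - phase_correlation F G' t"
    unfolding phase_correlation_def left_diff_distrib right_diff_distrib
    by (intro Bochner_Integration.integral_diff int assms)+
qed

text \<open>Fibre integrals are additive only for almost every \<omega>. Writing the mean product as
  an average of shifted correlations, which are integrals over the whole phase space and exist for
  every v, avoids handling exceptional frequencies.\<close>

lemma phase_mean_product_diff:
  fixes F F' G G' :: "(real ^ 'n) \<times> (real ^ 'n) \<Rightarrow> real"
  assumes F: "L2_torus_function F" "L2_torus_function F'" and G: "L2_torus_function G" "L2_torus_function G'"
  shows "phase_mean_product (\<lambda>z. F z - F' z) G = phase_mean_product F G - phase_mean_product F' G" (is ?left)
    and "phase_mean_product F (\<lambda>z. G z - G' z) = phase_mean_product F G - phase_mean_product F G'" (is ?right)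
proof -
  let ?m = "(2 * pi) ^ CARD('n) :: real"
  let ?L = "\<lambda>F G v. LINT z|phase_measure. F (fst z, snd z + v) * G z"
  have int: "integrable phase_measure (\<lambda>z. F (fst z, snd z + v) * G z)"
    if "L2_torus_function F" "L2_torus_function G" for F G :: "(real ^ 'n) \<times> (real ^ 'n) \<Rightarrow> real" and v
    using phase_correlation_shift(1)[OF that, of "\<lambda>_. v"] by simp
  have L: "integrable torus_measure (?L F G)" "(LINT v|torus_measure. ?L F G v) = ?m * phase_mean_product F G"
    if "L2_torus_function F" "L2_torus_function G" for F G :: "(real ^ 'n) \<times> (real ^ 'n) \<Rightarrow> real"
    using phase_average[OF that, of "\<lambda>_. 0"] by simp_all
  have "?m * phase_mean_product (\<lambda>z. F z - F' z) G = (LINT v|torus_measure. ?L F G v - ?L F' G v)"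
    using F G by (subst L(2)[symmetric])
      (auto intro!: L2_torus_function_diff Bochner_Integration.integral_cong
        simp: left_diff_distrib Bochner_Integration.integral_diff[OF int int])
  also have "\<dots> = ?m * (phase_mean_product F G - phase_mean_product F' G)"
    using F G by (subst Bochner_Integration.integral_diff[OF L(1) L(1)]) (auto simp: L(2) right_diff_distrib)
  finally show ?left by simp
  have "?m * phase_mean_product F (\<lambda>z. G z - G' z) = (LINT v|torus_measure. ?L F G v - ?L F G' v)"
    using F G by (subst L(2)[symmetric])
      (auto intro!: L2_torus_function_diff Bochner_Integration.integral_cong
        simp: right_diff_distrib Bochner_Integration.integral_diff[OF int int])
  also have "\<dots> = ?m * (phase_mean_product F G - phase_mean_product F G')"
    using F G by (subst Bochner_Integration.integral_diff[OF L(1) L(1)]) (auto simp: L(2) right_diff_distrib)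
  finally show ?right by simp
qed

theorem phase_correlation_tendsto:
  fixes F G :: "(real ^ 'n) \<times> (real ^ 'n) \<Rightarrow> real"
  assumes F: "L2_torus_function F" and G: "L2_torus_function G"
    and int: "integrable phase_measure F" "integrable phase_measure G"
  shows "(phase_correlation F G \<longlongrightarrow> phase_mean_product F G) at_infinity"
proof (rule tendstoI)
  fix e :: real assume e: "0 < e"
  note [measurable] = L2_torus_function_D(2)[OF F] L2_torus_function_D(2)[OF G]
  define T where "T H k = (\<lambda>z. if \<bar>H z\<bar> \<le> real k then H z else 0)"
    for H :: "(real ^ 'n) \<times> (real ^ 'n) \<Rightarrow> real" and k :: nat
  \<comment> \<open>The error does not involve t, so one truncation level k can be fixed before t
    tends to infinity.\<close>
  define err where "err k = phase_norm (\<lambda>z. F z - T F k z) * phase_norm G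
    + phase_norm F * phase_norm (\<lambda>z. G z - T G k z)" for k
  have T0: "(\<lambda>k. phase_norm (\<lambda>z. H z - T H k z)) \<longlonglongrightarrow> 0" if "L2_torus_function H" for H
    using tendsto_real_sqrt[OF L2_truncation_tendsto[OF L2_torus_function_D(2,3)[OF that]]]
    by (simp add: phase_norm_def T_def)
  have "err \<longlonglongrightarrow> 0 * phase_norm G + phase_norm F * 0"
    unfolding err_def by (intro tendsto_intros T0 F G)
  then have "\<forall>\<^sub>F k in sequentially. err k < e / 3"
    using e by (intro order_tendstoD) auto
  then obtain k where k: "err k < e / 3"
    using eventually_happens by force
  have TF: "L2_torus_function (T F k)" "phase_norm (T F k) \<le> phase_norm F" and TG: "L2_torus_function (T G k)"
    unfolding T_def using L2_torus_function_truncate F G by auto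
  have b1: "\<bar>phase_correlation F G t - phase_correlation (T F k) (T G k) t\<bar> \<le> err k" for t
  proof -
    have "\<bar>phase_correlation F G t\<bar> \<le> phase_norm F * phase_norm G"
      if "L2_torus_function F" "L2_torus_function G" for F G :: "(real ^ 'n) \<times> (real ^ 'n) \<Rightarrow> real"
      using phase_correlation_shift(2)[OF that, of "\<lambda>\<omega>. - t *\<^sub>R \<omega>"] by (simp add: phase_correlation_def)
    then show ?thesis
      unfolding err_def
      by (intro bilinear_perturbation[where b = "\<lambda>F G. phase_correlation F G t"] F G TF TG)
         (auto intro: phase_correlation_diff)
  qed
  have b2: "\<bar>phase_mean_product F G - phase_mean_product (T F k) (T G k)\<bar> \<le> err k"
    unfolding err_def
    by (intro bilinear_perturbation[where b = phase_mean_product] phase_mean_product_bound F G TF TG)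
       (auto intro: phase_mean_product_diff)
  have T_int: "integrable phase_measure (T H k)" if "integrable phase_measure H" for H
  proof (rule Bochner_Integration.integrable_bound[OF that])
    have [measurable]: "H \<in> borel_measurable phase_measure" using that by simp
    show "T H k \<in> borel_measurable phase_measure" unfolding T_def by measurable
  qed (auto simp: T_def)
  have "(phase_correlation (T F k) (T G k) \<longlongrightarrow> phase_mean_product (T F k) (T G k)) at_infinity"
    by (intro correlation_tendsto_bounded[where B = "real k"] TF TG T_int int) (auto simp: T_def)
  then have "\<forall>\<^sub>F t in at_infinity. dist (phase_correlation (T F k) (T G k) t) (phase_mean_product (T F k) (T G k)) < e / 3"
    using e by (intro tendstoD) auto
  then show "\<forall>\<^sub>F t in at_infinity. dist (phase_correlation F G t) (phase_mean_product F G) < e"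
  proof eventually_elim
    case (elim t)
    then show ?case
      using b1[of t] b2 k unfolding dist_real_def by linarith
  qed
qed

subsection \<open>Passage from Lebesgue to Borel functions\<close>

lemma torus_periodic_lattice:
  fixes f :: "(real ^ 'n) \<times> (real ^ 'n) \<Rightarrow> real"
  assumes "torus_periodic f"
  shows "f (\<omega>, x + lattice_point k) = f (\<omega>, x)"
proof -
  have per: "f (\<omega>, y + axis s (2 * pi)) = f (\<omega>, y)" for y s
    using assms by (simp add: torus_periodic_def)
  have nat: "f (\<omega>, y + real j *\<^sub>R axis s (2 * pi)) = f (\<omega>, y)" for y s j
  proof (induction j)
    case (Suc j)
    then show ?case
      using per[of "y + real j *\<^sub>R axis s (2 * pi)" s] by (simp add: algebra_simps)
  qed simp
  \<comment> \<open>For negative j the natural case is applied at the displaced point, from which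
    \<open>nat (- j)\<close> forward steps lead back to y.\<close>
  have int: "f (\<omega>, y + of_int j *\<^sub>R axis s (2 * pi)) = f (\<omega>, y)" for y s j
    using nat[of y "nat j" s] nat[of "y + of_int j *\<^sub>R axis s (2 * pi)" "nat (- j)" s]
    by (cases "0 \<le> j") (simp_all add: algebra_simps)
  have "f (\<omega>, y + (\<Sum>s\<in>S. of_int (k $ s) *\<^sub>R axis s (2 * pi))) = f (\<omega>, y)" if "finite S" for S y
    using that
  proof (induction S arbitrary: y)
    case (insert s S)
    then show ?case
      using int[of "y + (\<Sum>s\<in>S. of_int (k $ s) *\<^sub>R axis s (2 * pi))" "k $ s" s] by (simp add: algebra_simps)
  qed simp
  moreover have "lattice_point k = (\<Sum>s\<in>UNIV. of_int (k $ s) *\<^sub>R axis s (2 * pi))"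
    by (simp add: lattice_point_def vec_eq_iff sum_component axis_def if_distrib[of "\<lambda>x. _ * x"] sum.delta mult.commute
        cong: if_cong)
  ultimately show ?thesis by simp
qed

lemma torus_periodic_reduce:
  assumes "torus_periodic f"
  shows "f (\<omega>, torus_reduce x) = f (\<omega>, x)"
  using torus_periodic_lattice[OF assms, of \<omega> "torus_reduce x"] by (metis torus_reduce_def diff_add_cancel)

text \<open>Completeness of Lebesgue measure turns almost everywhere equality with a Borel function
  into measurability of h, so the lemma applies to sections of f and g, about which nothing else is
  known.\<close>

lemma lebesgue_transfer:
  fixes h h' :: "'a :: euclidean_space \<Rightarrow> real"
  assumes h': "h' \<in> borel_measurable borel" and ae: "AE x in lborel. h x = h' x"
  shows "integrable lebesgue h \<longleftrightarrow> integrable lborel h'" and "(LINT x|lebesgue. h x) = (LINT x|lborel. h' x)"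
proof -
  have m': "h' \<in> borel_measurable lebesgue" using h' by (intro measurable_completion) simp
  have ae': "AE x in lebesgue. h' x = h x" using AE_completion[OF ae] by (auto elim: AE_mp)
  have m: "h \<in> borel_measurable lebesgue" by (rule borel_measurable_AE[OF m' ae'])
  show "integrable lebesgue h \<longleftrightarrow> integrable lborel h'"
    using integrable_cong_AE[OF m' m ae'] h' by (simp add: integrable_completion)
  show "(LINT x|lebesgue. h x) = (LINT x|lborel. h' x)"
    using integral_cong_AE[OF m' m ae'] h' by (simp add: integral_completion)
qed

lemma set_lebesgue_transfer:
  fixes h h' :: "'a :: euclidean_space \<Rightarrow> real"
  assumes [measurable]: "h' \<in> borel_measurable borel" "C \<in> sets borel"
    and ae: "AE x in density lborel (indicator C). h x = h' x"
  shows "set_integrable lebesgue C h \<longleftrightarrow> integrable (density lborel (indicator C)) h'"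
    and "(LINT x:C|lebesgue. h x) = (LINT x|density lborel (indicator C). h' x)"
proof -
  have D: "density lborel (indicator C) = density lborel (\<lambda>x. ennreal (indicator C x))"
    by (simp add: ennreal_indicator)
  have m: "(\<lambda>x. indicator C x *\<^sub>R h' x) \<in> borel_measurable borel"
    by measurable
  have "AE x in lborel. indicator C x *\<^sub>R h x = indicator C x *\<^sub>R h' x"
    using ae by (subst (asm) AE_density) (auto elim!: AE_mp simp: indicator_def)
  note T = lebesgue_transfer[OF m this]
  show "set_integrable lebesgue C h \<longleftrightarrow> integrable (density lborel (indicator C)) h'"
    unfolding set_integrable_def T(1) D by (subst integrable_density) auto
  show "(LINT x:C|lebesgue. h x) = (LINT x|density lborel (indicator C). h' x)"
    unfolding set_lebesgue_integral_def T(2) D by (subst integral_density) auto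
qed

text \<open>The hypothesis controls f on the cell only. A Borel version of the cut-off function is
  therefore extended periodically by \<open>torus_reduce\<close>, which is the identity on the cell,
  where \<open>phase_measure\<close> lives.\<close>

lemma borel_torus_representative:
  fixes f :: "(real ^ 'n) \<times> (real ^ 'n) \<Rightarrow> real"
  assumes "phase_integrable f"
  obtains F where "torus_function F" "AE z in phase_measure. f z = F z"
proof -
  have "(\<lambda>z. indicator (UNIV \<times> torus_cell) z *\<^sub>R f z) \<in> borel_measurable lebesgue"
    using assms unfolding set_integrable_def by (rule borel_measurable_integrable)
  from completion_ex_borel_measurable_real[OF this]
  obtain F0 where F0: "F0 \<in> borel_measurable lborel"
    and ae: "AE z in lborel. indicator (UNIV \<times> torus_cell) z *\<^sub>R f z = F0 z"
    by auto
  have [measurable]: "F0 \<in> borel_measurable phase_measure"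
    using F0 by (metis measurable_cong_sets sets_lborel sets_phase_measure)
  let ?F = "\<lambda>z. F0 (fst z, torus_reduce (snd z))"
  have "?F \<in> borel_measurable phase_measure"
    by measurable
  then have F: "torus_function ?F"
    by (simp add: torus_function_def torus_reduce_eq_self torus_reduce_in_cell)
  have "AE z in lborel. 0 < (indicator (UNIV \<times> torus_cell) z :: ennreal) \<longrightarrow> f z = ?F z"
    using ae by eventually_elim (auto simp: indicator_def torus_reduce_eq_self split: if_splits)
  then have "AE z in phase_measure. f z = ?F z"
    unfolding phase_measure_density by (subst AE_density) auto
  with F show ?thesis by (rule that)
qed

text \<open>The integrability conclusions ensure that the integrals involved are genuine, since the
  integral of a non-integrable function is 0 by convention.\<close>

theorem theorem2:
  fixes f g :: "(real ^ 'n) \<times> (real ^ 'n) \<Rightarrow> real"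
  assumes "torus_periodic f" and "torus_periodic g"
    and "phase_integrable f" and "phase_integrable (\<lambda>z. (f z)\<^sup>2)"
    and "phase_integrable g" and "phase_integrable (\<lambda>z. (g z)\<^sup>2)"
  shows "(\<forall>t. phase_integrable (\<lambda>(\<omega>, x). f (\<omega>, x - t *\<^sub>R \<omega>) * g (\<omega>, x)))
    \<and> (AE \<omega> in lebesgue. set_integrable lebesgue torus_cell (\<lambda>x. f (\<omega>, x))
         \<and> set_integrable lebesgue torus_cell (\<lambda>x. g (\<omega>, x)))
    \<and> integrable lebesgue (\<lambda>\<omega>. torus_mean f \<omega> * torus_mean g \<omega>)
    \<and> (correlation f g \<longlongrightarrow>
         (2 * pi) ^ CARD('n) * (LINT \<omega>|lebesgue. torus_mean f \<omega> * torus_mean g \<omega>)) at_top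
    \<and> (correlation f g \<longlongrightarrow>
         (2 * pi) ^ CARD('n) * (LINT \<omega>|lebesgue. torus_mean f \<omega> * torus_mean g \<omega>)) at_bot"
proof -
  let ?m = "(2 * pi) ^ CARD('n) :: real"
  obtain F where F: "torus_function F" and fF: "AE z in phase_measure. f z = F z"
    using borel_torus_representative[OF assms(3)] by blast
  obtain G where G: "torus_function G" and gG: "AE z in phase_measure. g z = G z"
    using borel_torus_representative[OF assms(5)] by blast
  note [measurable] = torus_function_measurable[OF F] torus_function_measurable[OF G]
  have to_borel: "h \<in> borel_measurable borel" if "h \<in> borel_measurable phase_measure"
    for h :: "(real ^ 'n) \<times> (real ^ 'n) \<Rightarrow> real"
    using that by (metis measurable_cong_sets sets_phase_measure)
  have section_borel: "(\<lambda>x. h (\<omega>, x)) \<in> borel_measurable borel" if [measurable]: "h \<in> borel_measurable phase_measure"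
    for h :: "(real ^ 'n) \<times> (real ^ 'n) \<Rightarrow> real" and \<omega>
    by measurable
  have transfer: "phase_integrable h \<longleftrightarrow> integrable phase_measure H"
    if H: "H \<in> borel_measurable phase_measure" and ae: "AE z in phase_measure. h z = H z"
    for h H :: "(real ^ 'n) \<times> (real ^ 'n) \<Rightarrow> real"
    using set_lebesgue_transfer(1)[OF to_borel[OF H] sets_UNIV_times_torus_cell ae[unfolded phase_measure_density]]
    by (simp add: phase_measure_density)
  \<comment> \<open>By Fubini for null sets, for almost every \<omega> the two sections agree almost
    everywhere on the cell.\<close>
  have section_transfer: "AE \<omega> in lborel.
      (set_integrable lebesgue torus_cell (\<lambda>x. h (\<omega>, x)) \<longleftrightarrow> integrable torus_measure (\<lambda>x. H (\<omega>, x))) \<and>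
      (LINT x:torus_cell|lebesgue. h (\<omega>, x)) = (LINT x|torus_measure. H (\<omega>, x))"
    if H: "H \<in> borel_measurable phase_measure" and ae: "AE z in phase_measure. h z = H z"
    for h H :: "(real ^ 'n) \<times> (real ^ 'n) \<Rightarrow> real"
    using phase.AE_pair[OF ae]
  proof eventually_elim
    case (elim \<omega>)
    show ?case
      using set_lebesgue_transfer[OF section_borel[OF H] torus_cell_borel elim[unfolded torus_measure_def]]
      by (simp add: torus_measure_def)
  qed

  have Fint: "integrable phase_measure F" and Gint: "integrable phase_measure G"
    using transfer[OF _ fF] transfer[OF _ gG] assms by simp_all
  have F2: "L2_torus_function F"
  proof -
    have "AE z in phase_measure. (f z)\<^sup>2 = (F z)\<^sup>2"
      using fF by eventually_elim simp
    then show ?thesis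
      using transfer[of "\<lambda>z. (F z)\<^sup>2"] assms F by (simp add: L2_torus_function_def)
  qed
  have G2: "L2_torus_function G"
  proof -
    have "AE z in phase_measure. (g z)\<^sup>2 = (G z)\<^sup>2"
      using gG by eventually_elim simp
    then show ?thesis
      using transfer[of "\<lambda>z. (G z)\<^sup>2"] assms G by (simp add: L2_torus_function_def)
  qed

  let ?k = "\<lambda>t (\<omega>, x). f (\<omega>, x - t *\<^sub>R \<omega>) * g (\<omega>, x)"
  let ?K = "\<lambda>t z. F (fst z, snd z - t *\<^sub>R fst z) * G z"
  have K_int: "integrable phase_measure (?K t)" for t
    using phase_correlation_shift(1)[OF F2 G2, of "\<lambda>\<omega>. - t *\<^sub>R \<omega>"] by simp
  \<comment> \<open>Equality almost everywhere survives composition with the flow because the shear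
    preserves \<open>phase_measure\<close>, so preimages of null sets are null.\<close>
  have kK: "AE z in phase_measure. ?k t z = ?K t z" for t
  proof -
    note S = phase_measure_shear[of "\<lambda>\<omega>. - t *\<^sub>R \<omega>" 0]
    let ?S = "\<lambda>(\<omega>, x). (\<omega> + 0, torus_reduce (x + - t *\<^sub>R \<omega>))"
    have "AE z in phase_measure. f (?S z) = F (?S z)"
      by (rule AE_distrD[OF S(1)]) (simp_all only: S(2) fF borel_measurable_scaleR borel_measurable_const measurable_ident_sets)
    then show ?thesis
      using gG
    proof eventually_elim
      case (elim z)
      then show ?case
        by (cases z) (simp add: torus_periodic_reduce[OF assms(1)] torus_function_reduce[OF F])
    qed
  qed
  have 1: "phase_integrable (?k t)" for t
    using transfer[OF _ kK] K_int by simp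
  have 2: "AE \<omega> in lebesgue. set_integrable lebesgue torus_cell (\<lambda>x. f (\<omega>, x))
         \<and> set_integrable lebesgue torus_cell (\<lambda>x. g (\<omega>, x))"
  proof (rule AE_completion)
    show "AE \<omega> in lborel. set_integrable lebesgue torus_cell (\<lambda>x. f (\<omega>, x))
         \<and> set_integrable lebesgue torus_cell (\<lambda>x. g (\<omega>, x))"
      using section_transfer[OF torus_function_measurable[OF F] fF] section_transfer[OF torus_function_measurable[OF G] gG]
        phase.AE_integrable_fst'[OF Fint] phase.AE_integrable_fst'[OF Gint]
      by eventually_elim simp
  qed

  let ?I = "\<lambda>\<omega>. (LINT x|torus_measure. F (\<omega>, x)) * (LINT x|torus_measure. G (\<omega>, x))"
  \<comment> \<open>Each mean contributes one factor \<open>1 / ?m\<close>; the factor in front of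
    the limit cancels one of the two.\<close>
  have means: "AE \<omega> in lborel. torus_mean f \<omega> * torus_mean g \<omega> = ?I \<omega> / ?m\<^sup>2"
    using section_transfer[OF torus_function_measurable[OF F] fF] section_transfer[OF torus_function_measurable[OF G] gG]
    by eventually_elim (simp add: torus_mean_def power2_eq_square)
  have I: "integrable lborel ?I"
    using phase_average(3)[OF F2 G2, of "\<lambda>_. 0"] by simp
  have "(\<lambda>\<omega>. ?I \<omega> / ?m\<^sup>2) \<in> borel_measurable borel"
    using borel_measurable_integrable[OF I] by simp
  note M = lebesgue_transfer[OF this means]
  have 3: "integrable lebesgue (\<lambda>\<omega>. torus_mean f \<omega> * torus_mean g \<omega>)"
    using I by (simp add: M(1))
  have limit: "?m * (LINT \<omega>|lebesgue. torus_mean f \<omega> * torus_mean g \<omega>) = phase_mean_product F G"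
    by (simp add: M(2) phase_mean_product_def power2_eq_square)

  have "correlation f g t = phase_correlation F G t" for t
  proof -
    \<comment> \<open>The exceptional frequencies may depend on t, but t is fixed here, so the
      correlations agree at every t.\<close>
    have ae: "AE \<omega> in lborel. (LINT x:torus_cell|lebesgue. f (\<omega>, x - t *\<^sub>R \<omega>) * g (\<omega>, x)) =
        (LINT x|torus_measure. ?K t (\<omega>, x))"
      using section_transfer[OF borel_measurable_integrable[OF K_int] kK, of t] by eventually_elim simp
    have "(\<lambda>\<omega>. LINT x|torus_measure. ?K t (\<omega>, x)) \<in> borel_measurable borel"
      using borel_measurable_integrable[OF phase.integrable_fst'[OF K_int[of t]]] by simp
    then have "correlation f g t = (LINT \<omega>|lborel. LINT x|torus_measure. ?K t (\<omega>, x))"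
      unfolding correlation_def by (rule lebesgue_transfer(2)[OF _ ae])
    also have "\<dots> = phase_correlation F G t"
      unfolding phase_correlation_def by (rule phase.integral_fst'[OF K_int])
    finally show ?thesis .
  qed
  then have "correlation f g = phase_correlation F G"
    by (rule ext)
  then have "(correlation f g \<longlongrightarrow> phase_mean_product F G) at_infinity"
    using phase_correlation_tendsto[OF F2 G2 Fint Gint] by simp
  then have "(correlation f g \<longlongrightarrow> phase_mean_product F G) at_top" "(correlation f g \<longlongrightarrow> phase_mean_product F G) at_bot"
    by (auto intro: tendsto_mono at_top_le_at_infinity at_bot_le_at_infinity)
  with 1 2 3 show ?thesis
    unfolding limit by blast
qed

end
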